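(* For any quantum protocol (allowing arbitrary entangled operations, auxiliary systems, and fully adaptive strategies), the query complexity for solving the black-box distinguishing task below, when the device provides only classical measurement outcomes (no post-measurement states), with constant success probability is $\Omega(\sqrt{d})$.
   Context: Black-box distinguishing task: given query access to a measurement device on a $d$-dimensional system, distinguish between the following two scenarios, each occurring with equal prior probability: (i) the device outputs $i \in \{0,\dots,d-1\}$ uniformly at random and leaves the input state unchanged (equivalently, it implements the trivial POVM $\{M_i = \mathbb{I}/d\}_i$); (ii) the device performs a projective measurement with operators $\{\Pi_i = U |i\rangle\langle i| U^\dagger\}_{i=0}^{d-1}$ on the input state, where $U$ is an unknown $d$-dimensional Haar random unitary, outputs the measurement result $i$, and collapses the input state to the corresponding post-measurement state. In the setting of this theorem, the tester only has access to the classical outcomes of the device. *)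

theory Defs
  imports "HOL-Probability.Probability" "Jordan_Normal_Form.Schur_Decomposition"
begin

definition mtrace :: "complex mat \<Rightarrow> complex" where
  "mtrace A = (\<Sum>i<dim_row A. A $$ (i,i))"

definition unitary_mat :: "nat \<Rightarrow> complex mat \<Rightarrow> bool" where
  "unitary_mat d U \<longleftrightarrow> U \<in> carrier_mat d d \<and> mat_adjoint U * U = 1\<^sub>m d"

definition psd_mat :: "nat \<Rightarrow> complex mat \<Rightarrow> bool" where
  "psd_mat n A \<longleftrightarrow> A \<in> carrier_mat n n \<and>
     (\<forall>v \<in> carrier_vec n. Im ((A *\<^sub>v v) \<bullet>c v) = 0 \<and> 0 \<le> Re ((A *\<^sub>v v) \<bullet>c v))"

definition density_mat :: "nat \<Rightarrow> complex mat \<Rightarrow> bool" where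
  "density_mat n \<rho> \<longleftrightarrow> psd_mat n \<rho> \<and> mtrace \<rho> = 1"

(* Kronecker product; index (a,w) of C^p (x) C^q is encoded as a*q + w *)
definition kron :: "complex mat \<Rightarrow> complex mat \<Rightarrow> complex mat" where
  "kron A B = mat (dim_row A * dim_row B) (dim_col A * dim_col B)
     (\<lambda>(i,j). A $$ (i div dim_row B, j div dim_col B) * B $$ (i mod dim_row B, j mod dim_col B))"

definition ptrace_first :: "nat \<Rightarrow> nat \<Rightarrow> complex mat \<Rightarrow> complex mat" where
  "ptrace_first d m X = mat m m (\<lambda>(w,w'). \<Sum>a<d. X $$ (a*m + w, a*m + w'))"

definition kraus_channel :: "nat \<Rightarrow> nat \<Rightarrow> complex mat list \<Rightarrow> bool" where
  "kraus_channel m n Ks \<longleftrightarrow> (\<forall>K \<in> set Ks. K \<in> carrier_mat n m) \<and>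
     foldr (\<lambda>K acc. mat_adjoint K * K + acc) Ks (0\<^sub>m m m) = 1\<^sub>m m"

definition apply_kraus :: "nat \<Rightarrow> complex mat list \<Rightarrow> complex mat \<Rightarrow> complex mat" where
  "apply_kraus n Ks \<omega> = foldr (\<lambda>K acc. K * \<omega> * mat_adjoint K + acc) Ks (0\<^sub>m n n)"

(* A T-query protocol with workspace C^m (m arbitrary):
   rho0 : initial workspace state;
   Phi h : channel (Kraus operators) C^m -> C^d (x) C^m applied before the next query,
           depending on the outcome history h (histories are stored most recent outcome first);
   F h  : final two-outcome POVM element ("guess scenario (ii)") after T queries with history h.
   At each query the device acts on the C^d factor, returns only the classical outcome i,
   and the C^d factor is NOT returned (it is traced out). *)
definition valid_protocol ::
  "nat \<Rightarrow> nat \<Rightarrow> nat \<Rightarrow> complex mat \<Rightarrow> (nat list \<Rightarrow> complex mat list) \<Rightarrow> (nat list \<Rightarrow> complex mat) \<Rightarrow> bool" where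
  "valid_protocol d m T \<rho>0 \<Phi> F \<longleftrightarrow> 0 < m \<and> density_mat m \<rho>0 \<and>
     (\<forall>h. length h < T \<longrightarrow> set h \<subseteq> {..<d} \<longrightarrow> kraus_channel m (d*m) (\<Phi> h)) \<and>
     (\<forall>h. length h = T \<longrightarrow> set h \<subseteq> {..<d} \<longrightarrow> psd_mat m (F h) \<and> psd_mat m (1\<^sub>m m - F h))"

(* unnormalised workspace state after outcome history h, for device POVM elements M i *)
fun run :: "nat \<Rightarrow> nat \<Rightarrow> complex mat \<Rightarrow> (nat list \<Rightarrow> complex mat list) \<Rightarrow> (nat \<Rightarrow> complex mat)
             \<Rightarrow> nat list \<Rightarrow> complex mat" where
  "run d m \<rho>0 \<Phi> M [] = \<rho>0"
| "run d m \<rho>0 \<Phi> M (i # h) =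
     ptrace_first d m (kron (M i) (1\<^sub>m m) * apply_kraus (d*m) (\<Phi> h) (run d m \<rho>0 \<Phi> M h))"

definition histories :: "nat \<Rightarrow> nat \<Rightarrow> nat list set" where
  "histories d T = {h. length h = T \<and> set h \<subseteq> {..<d}}"

definition accept_prob ::
  "nat \<Rightarrow> nat \<Rightarrow> nat \<Rightarrow> complex mat \<Rightarrow> (nat list \<Rightarrow> complex mat list) \<Rightarrow> (nat list \<Rightarrow> complex mat)
     \<Rightarrow> (nat \<Rightarrow> complex mat) \<Rightarrow> real" where
  "accept_prob d m T \<rho>0 \<Phi> F M = Re (\<Sum>h \<in> histories d T. mtrace (F h * run d m \<rho>0 \<Phi> M h))"

definition trivial_povm :: "nat \<Rightarrow> nat \<Rightarrow> complex mat" where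
  "trivial_povm d i = (1 / of_nat d) \<cdot>\<^sub>m 1\<^sub>m d"

definition basis_proj :: "nat \<Rightarrow> nat \<Rightarrow> complex mat" where
  "basis_proj d i = mat d d (\<lambda>(a,b). if a = i \<and> b = i then 1 else 0)"

definition rotated_povm :: "nat \<Rightarrow> complex mat \<Rightarrow> nat \<Rightarrow> complex mat" where
  "rotated_povm d U i = U * basis_proj d i * mat_adjoint U"

definition unitary_space :: "nat \<Rightarrow> complex mat measure" where
  "unitary_space d = sigma {U. unitary_mat d U}
     {{U. unitary_mat d U \<and> U $$ (i,j) \<in> B} | i j B. i < d \<and> j < d \<and> B \<in> sets borel}"

definition haar_measure :: "nat \<Rightarrow> complex mat measure \<Rightarrow> bool" where
  "haar_measure d \<mu> \<longleftrightarrow> prob_space \<mu> \<and> sets \<mu> = sets (unitary_space d) \<and>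
     (\<forall>V. unitary_mat d V \<longrightarrow> distr \<mu> \<mu> (\<lambda>U. V * U) = \<mu>)"

definition success_prob ::
  "nat \<Rightarrow> complex mat measure \<Rightarrow> nat \<Rightarrow> nat \<Rightarrow> complex mat \<Rightarrow> (nat list \<Rightarrow> complex mat list)
     \<Rightarrow> (nat list \<Rightarrow> complex mat) \<Rightarrow> real" where
  "success_prob d \<mu> m T \<rho>0 \<Phi> F =
     1/2 * (1 - accept_prob d m T \<rho>0 \<Phi> F (trivial_povm d)) +
     1/2 * (\<integral>U. accept_prob d m T \<rho>0 \<Phi> F (rotated_povm d U) \<partial>\<mu>)"

end

theory Submission
  imports Defs
begin

text \<open>
  Expanding all Kraus operators, the initial state and the final effects into rank-one terms, the
  probability of an outcome history \<open>h\<close> together with a guess becomes a sum of squares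
  \<open>|\<psi>\<^sub>U(h)|\<^sup>2\<close>, where \<open>\<psi>\<^sub>U = (U\<^sup>*)\<^sup>\<otimes>\<^sup>T v\<close> for a vector \<open>v\<close> that depends on the protocol and on \<open>h\<close>
  but not on the device; for the trivial device the same term is \<open>\<parallel>v\<parallel>\<^sup>2 / d\<^sup>T\<close>. It therefore suffices
  to bound the Haar average of \<open>|\<psi>\<^sub>U(h)|\<^sup>2\<close> from below when \<open>h\<close> has no repeated outcome.
  This average is the same for all such \<open>h\<close> because the Haar measure is invariant under permuting the
  columns of \<open>U\<close>. By Parseval the squares sum to \<open>\<parallel>v\<parallel>\<^sup>2\<close> over all histories, and the second moments
  of a Haar random column show that the histories with \<open>h\<^sub>j = h\<^sub>k\<close> contribute at most
  \<open>2 \<parallel>v\<parallel>\<^sup>2 / (d + 1)\<close> on average. Hence the average is at least \<open>(1 - 2 T\<^sup>2 / d) \<parallel>v\<parallel>\<^sup>2 / d\<^sup>T\<close>. Since the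
  trivial device repeats an outcome with probability at most \<open>T\<^sup>2 / d\<close>, the two scenarios
  can only be told apart with advantage of order \<open>T\<^sup>2 / d\<close>.
\<close>

text \<open>Only an upper bound on the advantage is needed, so a one-sided estimate suffices. It is
  applied to the effects \<open>1\<^sub>m m - F h\<close> of guess (i): on average the rotated
  device is rejected almost as often as the trivial one. Adaptivity costs nothing, because once
  \<open>h\<close> is fixed all channels are fixed. Averaging the square for one injective history
  directly would need Haar moments of degree T in the entries and in their conjugates (Weingarten
  calculus). Comparing the sum over all injective histories with Parseval avoids this: what is
  subtracted are collisions of a pair of positions, and the free sum over the other T - 2 positions
  collapses by unitarity, leaving degree two in the entries of one column and two in their
  conjugates. Diagonal phases and one reflection determine these moments. The threshold sqrt d is
  thus that of the birthday problem. Permuting columns is a right translation, while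
  \<open>haar_measure\<close> supplies left invariance, so right invariance has to be derived. The
  rank-one terms come from a Cholesky elimination, which needs no spectral theorem.\<close>

section \<open>Entries of adjoints and products\<close>

lemma dim_mat_adjoint [simp]:
  "dim_row (mat_adjoint A) = dim_col A" "dim_col (mat_adjoint A) = dim_row A"
  by (simp_all add: mat_adjoint_def)

lemma mat_adjoint_carrier: "A \<in> carrier_mat n m \<Longrightarrow> mat_adjoint A \<in> carrier_mat m n"
  by (intro carrier_matI) simp_all

lemma mat_adjoint_index [simp]:
  fixes A :: "complex mat"
  assumes "i < dim_col A" "j < dim_row A"
  shows "mat_adjoint A $$ (i, j) = cnj (A $$ (j, i))"
  using assms by (simp add: mat_adjoint_def mat_of_rows_def)

lemma times_mat_index:
  fixes A B :: "complex mat"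
  assumes "A \<in> carrier_mat n m" "B \<in> carrier_mat m k" "i < n" "j < k"
  shows "(A * B) $$ (i, j) = (\<Sum>l<m. A $$ (i, l) * B $$ (l, j))"
  using assms by (simp add: scalar_prod_def atLeast0LessThan)

lemma sum_lessThan_single:
  fixes g :: "nat \<Rightarrow> 'a::comm_monoid_add"
  assumes "i < n" "\<And>j. j < n \<Longrightarrow> j \<noteq> i \<Longrightarrow> g j = 0"
  shows "(\<Sum>j<n. g j) = g i"
proof -
  have "(\<Sum>j<n. g j) = (\<Sum>j\<in>{i}. g j)"
    using assms by (intro sum.mono_neutral_right) auto
  then show ?thesis by simp
qed

subsection \<open>Positive semidefinite matrices\<close>

lemma psd_mat_quadratic_form:
  assumes A: "A \<in> carrier_mat n n" and v: "v \<in> carrier_vec n"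
  shows "(A *\<^sub>v v) \<bullet>c v = (\<Sum>i<n. \<Sum>j<n. cnj (v $ i) * A $$ (i, j) * v $ j)"
proof -
  have "(A *\<^sub>v v) \<bullet>c v = (\<Sum>i<n. (\<Sum>j<n. A $$ (i, j) * v $ j) * cnj (v $ i))"
    using assms by (simp add: scalar_prod_def atLeast0LessThan)
  also have "\<dots> = (\<Sum>i<n. \<Sum>j<n. cnj (v $ i) * A $$ (i, j) * v $ j)"
    by (simp add: sum_distrib_left sum_distrib_right mult_ac)
  finally show ?thesis .
qed

text \<open>Entries are kept as a function so that rank-one terms can be subtracted without carrier
  conditions. The order on \<open>complex\<close> compares only numbers with equal imaginary part,
  so the inequality also says that the form is real.\<close>

definition psd_fun :: "nat \<Rightarrow> (nat \<Rightarrow> nat \<Rightarrow> complex) \<Rightarrow> bool" where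
  "psd_fun n f \<longleftrightarrow> (\<forall>x. 0 \<le> (\<Sum>i<n. \<Sum>j<n. cnj (x i) * f i j * x j))"

lemma psd_mat_imp_psd_fun:
  assumes "psd_mat n A"
  shows "psd_fun n (\<lambda>i j. A $$ (i, j))"
  unfolding psd_fun_def
proof
  fix x :: "nat \<Rightarrow> complex"
  have A: "A \<in> carrier_mat n n" using assms by (simp add: psd_mat_def)
  have "(A *\<^sub>v vec n x) \<bullet>c vec n x = (\<Sum>i<n. \<Sum>j<n. cnj (x i) * A $$ (i, j) * x j)"
    by (subst psd_mat_quadratic_form[OF A]) auto
  moreover have "0 \<le> (A *\<^sub>v vec n x) \<bullet>c vec n x"
    using assms by (auto simp: psd_mat_def less_eq_complex_def)
  ultimately show "0 \<le> (\<Sum>i<n. \<Sum>j<n. cnj (x i) * A $$ (i, j) * x j)" by simp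
qed

lemma psd_fun_two_point:
  assumes f: "psd_fun n f" and ij: "i < n" "j < n" "i \<noteq> j"
  shows "0 \<le> cnj a * f i i * a + cnj a * f i j * b + cnj b * f j i * a + cnj b * f j j * b"
proof -
  define x where "x l = (if l = i then a else if l = j then b else 0)" for l
  have s: "(\<Sum>l<n. g l (x l)) = g i a + g j b" if "\<And>l. g l 0 = 0" for g :: "nat \<Rightarrow> complex \<Rightarrow> complex"
  proof -
    have "(\<Sum>l<n. g l (x l)) = (\<Sum>l\<in>{i, j}. g l (x l))"
      using ij that by (intro sum.mono_neutral_right) (auto simp: x_def)
    then show ?thesis using ij by (simp add: x_def)
  qed
  have "(\<Sum>k<n. \<Sum>l<n. cnj (x k) * f k l * x l)
      = (\<Sum>k<n. cnj (x k) * f k i * a + cnj (x k) * f k j * b)"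
    by (intro sum.cong refl) (rule s[of "\<lambda>l y. cnj _ * f _ l * y"], simp)
  also have "\<dots> = cnj a * f i i * a + cnj a * f i j * b + (cnj b * f j i * a + cnj b * f j j * b)"
    by (rule s[of "\<lambda>k y. cnj y * f k i * a + cnj y * f k j * b"]) simp
  finally have "(\<Sum>k<n. \<Sum>l<n. cnj (x k) * f k l * x l)
      = cnj a * f i i * a + cnj a * f i j * b + cnj b * f j i * a + cnj b * f j j * b"
    by (simp only: add.assoc)
  then show ?thesis using f[unfolded psd_fun_def, rule_format, of x] by simp
qed

lemma psd_fun_diag:
  assumes f: "psd_fun n f" and i: "i < n"
  shows "0 \<le> f i i"
proof -
  define x where "x l = (if l = i then 1 else 0 :: complex)" for l
  have "(\<Sum>k<n. \<Sum>l<n. cnj (x k) * f k l * x l) = (\<Sum>k<n. cnj (x k) * f k i * x i)"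
    using i by (intro sum.cong sum_lessThan_single) (auto simp: x_def)
  also have "\<dots> = cnj (x i) * f i i * x i"
    using i by (intro sum_lessThan_single) (auto simp: x_def)
  finally show ?thesis
    using f[unfolded psd_fun_def, rule_format, of x] by (simp add: x_def)
qed

text \<open>Polarisation: reality of the form at (1, 1) and at (1, \<i>) on the coordinates
  \<open>i\<close>, \<open>j\<close> fixes the imaginary part of the sum and the real part of the
  difference of \<open>f i j\<close> and \<open>f j i\<close>.\<close>

lemma psd_fun_hermitian:
  assumes f: "psd_fun n f" and ij: "i < n" "j < n"
  shows "f j i = cnj (f i j)"
proof (cases "i = j")
  case True
  then show ?thesis using psd_fun_diag[OF f] ij by (auto simp: less_eq_complex_def complex_eq_iff)
next
  case False
  have "0 \<le> f i i" "0 \<le> f j j" using psd_fun_diag[OF f] ij by auto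
  moreover have "0 \<le> f i i + f i j + f j i + f j j"
    using psd_fun_two_point[OF f ij False, of 1 1] by simp
  moreover have "0 \<le> f i i + f i j * \<i> - \<i> * f j i + f j j"
    using psd_fun_two_point[OF f ij False, of 1 \<i>] by (simp add: algebra_simps)
  ultimately show ?thesis by (auto simp: less_eq_complex_def complex_eq_iff)
qed

lemma psd_fun_zero_diag:
  assumes f: "psd_fun n f" and ij: "i < n" "j < n" and z: "f i i = 0"
  shows "f i j = 0"
proof (cases "i = j")
  case False
  define c where "c = f i j"
  have h: "f j i = cnj c" using psd_fun_hermitian[OF f ij] by (simp add: c_def)
  show ?thesis
  proof (rule ccontr)
    assume "f i j \<noteq> 0"
    then have c0: "c \<noteq> 0" by (simp add: c_def)
    \<comment> \<open>At the vector with entries - s c at \<open>i\<close> and 1 at \<open>j\<close>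
      the form equals \<open>f j j\<close> - 2 s |c|^2. This \<open>s\<close> makes it -
      \<open>f j j\<close> - 2, which is negative.\<close>
    define s where "s = (Re (f j j) + 1) / (cmod c)\<^sup>2"
    have "0 \<le> cnj (- (of_real s * c)) * f i j + f j i * (- (of_real s * c)) + f j j"
      using psd_fun_two_point[OF f ij False, of "- (of_real s * c)" 1] z by simp
    then have "0 \<le> - 2 * s * (cmod c)\<^sup>2 + Re (f j j)"
      unfolding h c_def[symmetric]
      by (auto simp: less_eq_complex_def cmod_power2) (auto simp: power2_eq_square algebra_simps)
    moreover have "s * (cmod c)\<^sup>2 = Re (f j j) + 1" using c0 by (simp add: s_def)
    ultimately have "Re (f j j) \<le> - 2" by (simp add: algebra_simps)
    then show False using psd_fun_diag[OF f ij(2)] by (simp add: less_eq_complex_def)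
  qed
qed (use z in simp)


text \<open>One elimination step: \<open>y\<close> is column \<open>k\<close> divided by the square
  root of the pivot, and what remains is the Schur complement. A zero pivot forces row and column
  \<open>k\<close> to vanish, so \<open>y\<close> = 0 works there. The last property keeps rows and
  columns that are already cleared at zero.\<close>

lemma psd_fun_cholesky_step:
  assumes f: "psd_fun n f" and k: "k < n"
  obtains y where "psd_fun n (\<lambda>i j. f i j - y i * cnj (y j))"
    and "\<And>i. i < n \<Longrightarrow> f i k = y i * cnj (y k)"
    and "\<And>i. i < n \<Longrightarrow> f k i = y k * cnj (y i)"
    and "\<And>i. i < n \<Longrightarrow> f i k = 0 \<Longrightarrow> y i = 0"
proof (cases "f k k = 0")
  case True
  then have z: "f k i = 0" "f i k = 0" if "i < n" for i
    using psd_fun_zero_diag[OF f k that] psd_fun_hermitian[OF f k that] by auto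
  show ?thesis by (rule that[of "\<lambda>_. 0"]) (use f z in auto)
next
  case False
  define r where "r = Re (f k k)"
  have fkk: "f k k = of_real r" and r: "r > 0"
    using psd_fun_diag[OF f k] False by (auto simp: r_def less_eq_complex_def complex_eq_iff)
  define y where "y i = f i k / of_real (sqrt r)" for i
  have sq: "complex_of_real (sqrt r) * complex_of_real (sqrt r) = of_real r"
    using r by (simp flip: of_real_mult)
  have yy: "y i * cnj (y j) = f i k * cnj (f j k) / of_real r" for i j
    unfolding y_def by (simp add: sq)
  have herm: "cnj (f i k) = f k i" "cnj (f k i) = f i k" if "i < n" for i
    using psd_fun_hermitian[OF f k that] by simp_all
  show ?thesis
  proof (rule that[of y])
    show "psd_fun n (\<lambda>i j. f i j - y i * cnj (y j))"
      unfolding psd_fun_def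
    proof
      fix x :: "nat \<Rightarrow> complex"
      define S where "S = (\<Sum>j<n. f k j * x j)"
      define x' where "x' i = x i - (if i = k then S / of_real r else 0)" for i
      have cS: "cnj S = (\<Sum>i<n. cnj (x i) * f i k)"
        unfolding S_def cnj_sum by (intro sum.cong refl) (simp add: herm)
      have inner: "(\<Sum>j<n. f i j * x' j) = (\<Sum>j<n. f i j * x j) - f i k * S / of_real r" for i
      proof -
        have "(\<Sum>j<n. f i j * x' j) = (\<Sum>j<n. f i j * x j)
            - (\<Sum>j<n. f i j * (if j = k then S / of_real r else 0))"
          by (simp add: x'_def right_diff_distrib sum_subtractf)
        also have "(\<Sum>j<n. f i j * (if j = k then S / of_real r else 0)) = f i k * S / of_real r"
          using k by (subst sum_lessThan_single[of k]) auto
        finally show ?thesis .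
      qed
      define g where "g i = (\<Sum>j<n. f i j * x j) - f i k * S / of_real r" for i
      \<comment> \<open>\<open>g\<close> is \<open>f\<close> applied to \<open>x'\<close>. Since it
        vanishes at \<open>k\<close>, the only place where \<open>x\<close> and \<open>x'\<close>
        differ, \<open>x'\<close> may be replaced by \<open>x\<close> on the left.\<close>
      have gk: "g k = 0" using r by (simp add: g_def S_def[symmetric] fkk)
      have "(\<Sum>i<n. \<Sum>j<n. cnj (x' i) * f i j * x' j) = (\<Sum>i<n. cnj (x' i) * g i)"
        unfolding g_def inner[symmetric] by (simp add: sum_distrib_left mult.assoc)
      also have "\<dots> = (\<Sum>i<n. cnj (x i) * g i)"
        by (intro sum.cong refl) (auto simp: x'_def gk)
      also have "\<dots> = (\<Sum>i<n. cnj (x i) * (\<Sum>j<n. f i j * x j)) - cnj S * S / of_real r"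
        unfolding g_def cS
        by (simp add: right_diff_distrib sum_subtractf sum_distrib_right sum_divide_distrib mult.assoc)
      also have "cnj S * S / of_real r = (\<Sum>i<n. cnj (x i) * (\<Sum>j<n. y i * cnj (y j) * x j))"
        unfolding yy cS S_def sum_distrib_right
        by (simp add: sum_divide_distrib sum_distrib_left herm mult_ac)
      also have "(\<Sum>i<n. cnj (x i) * (\<Sum>j<n. f i j * x j)) - \<dots>
          = (\<Sum>i<n. \<Sum>j<n. cnj (x i) * (f i j - y i * cnj (y j)) * x j)"
        by (simp add: sum_subtractf sum_distrib_left algebra_simps)
      finally show "0 \<le> (\<Sum>i<n. \<Sum>j<n. cnj (x i) * (f i j - y i * cnj (y j)) * x j)"
        using f[unfolded psd_fun_def, rule_format, of x'] by simp
    qed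
  qed (use k r in \<open>simp_all add: yy fkk herm\<close>, simp add: y_def)
qed

text \<open>Induction on the number of pivots left; the invariant is that the first \<open>k\<close>
  rows and columns have been cleared.\<close>

lemma psd_fun_cholesky_aux:
  assumes "psd_fun n f" "k \<le> n" "\<And>i j. i < n \<Longrightarrow> j < n \<Longrightarrow> i < k \<or> j < k \<Longrightarrow> f i j = 0"
  shows "\<exists>ys. \<forall>i<n. \<forall>j<n. f i j = (\<Sum>y\<leftarrow>ys. y i * cnj (y j))"
  using assms
proof (induction "n - k" arbitrary: k f)
  case 0
  then show ?case by (intro exI[of _ "[]"]) auto
next
  case (Suc l)
  then have k: "k < n" by simp
  obtain y where y: "psd_fun n (\<lambda>i j. f i j - y i * cnj (y j))"
    "\<And>i. i < n \<Longrightarrow> f i k = y i * cnj (y k)" "\<And>i. i < n \<Longrightarrow> f k i = y k * cnj (y i)"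
    "\<And>i. i < n \<Longrightarrow> f i k = 0 \<Longrightarrow> y i = 0"
    by (rule psd_fun_cholesky_step[OF Suc.prems(1) k]) blast
  have y0: "y i = 0" if "i < k" for i using y(4)[of i] Suc.prems(3)[of i k] k that by auto
  have "\<exists>ys. \<forall>i<n. \<forall>j<n. f i j - y i * cnj (y j) = (\<Sum>y\<leftarrow>ys. y i * cnj (y j))"
  proof (rule Suc.hyps(1))
    show "l = n - Suc k" "Suc k \<le> n" using Suc.hyps(2) k by auto
    show "psd_fun n (\<lambda>i j. f i j - y i * cnj (y j))" by fact
    show "f i j - y i * cnj (y j) = 0" if "i < n" "j < n" "i < Suc k \<or> j < Suc k" for i j
      using that y(2)[of i] y(3)[of j] y0 Suc.prems(3)[of i j] by (auto simp: less_Suc_eq)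
  qed
  then obtain ys where ys: "\<forall>i<n. \<forall>j<n. f i j - y i * cnj (y j) = (\<Sum>y\<leftarrow>ys. y i * cnj (y j))"
    by blast
  show ?case
  proof (intro exI[of _ "y # ys"] allI impI)
    fix i j assume "i < n" "j < n"
    then have "f i j - y i * cnj (y j) = (\<Sum>y\<leftarrow>ys. y i * cnj (y j))" using ys by blast
    then show "f i j = (\<Sum>y\<leftarrow>y # ys. y i * cnj (y j))" by (simp add: algebra_simps)
  qed
qed

lemma psd_mat_rank_one_decomposition:
  assumes "psd_mat n A"
  obtains ys :: "(nat \<Rightarrow> complex) list"
  where "\<And>i j. i < n \<Longrightarrow> j < n \<Longrightarrow> A $$ (i, j) = (\<Sum>y\<leftarrow>ys. y i * cnj (y j))"
proof -
  have "\<exists>ys. \<forall>i<n. \<forall>j<n. A $$ (i, j) = (\<Sum>y\<leftarrow>ys. y i * cnj (y j))"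
    by (rule psd_fun_cholesky_aux[OF psd_mat_imp_psd_fun[OF assms], of 0]) simp_all
  then show ?thesis using that by blast
qed

subsection \<open>Path representation of a protocol\<close>

lemma sum_lessThan_times:
  fixes g :: "nat \<Rightarrow> 'a::comm_monoid_add"
  shows "(\<Sum>x<d * m. g x) = (\<Sum>b<d. \<Sum>u<m. g (b * m + u))"
proof -
  have "(\<Sum>x<d * m. g x) = (\<Sum>b<d. sum g {b * m..<b * m + m})"
    by (rule sum.nat_group[symmetric])
  also have "\<dots> = (\<Sum>b<d. \<Sum>u<m. g (b * m + u))"
    by (simp add: sum.atLeastLessThan_shift_0 atLeast0LessThan)
  finally show ?thesis .
qed

lemma mult_add_less:
  fixes a d m w :: nat
  assumes "a < d" "w < m"
  shows "a * m + w < d * m"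
proof -
  have "a * m + w < Suc a * m" using assms by simp
  also have "\<dots> \<le> d * m" using assms by (intro mult_right_mono) auto
  finally show ?thesis .
qed

lemma sum_swap_pairs:
  fixes f :: "'a \<Rightarrow> 'b \<Rightarrow> 'c \<Rightarrow> 'd \<Rightarrow> 'e::comm_monoid_add"
  shows "(\<Sum>u\<in>A. \<Sum>v\<in>B. \<Sum>a\<in>C. \<Sum>b\<in>D. f u v a b) = (\<Sum>a\<in>C. \<Sum>b\<in>D. \<Sum>u\<in>A. \<Sum>v\<in>B. f u v a b)"
proof -
  have "(\<Sum>u\<in>A. \<Sum>v\<in>B. \<Sum>a\<in>C. \<Sum>b\<in>D. f u v a b) = (\<Sum>u\<in>A. \<Sum>a\<in>C. \<Sum>v\<in>B. \<Sum>b\<in>D. f u v a b)"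
    by (intro sum.cong refl sum.swap)
  also have "\<dots> = (\<Sum>a\<in>C. \<Sum>u\<in>A. \<Sum>v\<in>B. \<Sum>b\<in>D. f u v a b)"
    by (rule sum.swap)
  also have "\<dots> = (\<Sum>a\<in>C. \<Sum>u\<in>A. \<Sum>b\<in>D. \<Sum>v\<in>B. f u v a b)"
    by (intro sum.cong refl sum.swap)
  also have "\<dots> = (\<Sum>a\<in>C. \<Sum>b\<in>D. \<Sum>u\<in>A. \<Sum>v\<in>B. f u v a b)"
    by (intro sum.cong refl sum.swap)
  finally show ?thesis .
qed

lemma sum_sum_list_swap:
  fixes f :: "'a \<Rightarrow> 'b \<Rightarrow> 'c::comm_monoid_add"
  shows "(\<Sum>x\<in>A. \<Sum>y\<leftarrow>ys. f x y) = (\<Sum>y\<leftarrow>ys. \<Sum>x\<in>A. f x y)"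
  by (induction ys) (auto simp: sum.distrib)

lemma sum_list_concat_map_map:
  fixes f :: "'a \<Rightarrow> 'c::comm_monoid_add"
  shows "(\<Sum>x\<leftarrow>concat (map (\<lambda>k. map (g k) ws) ks). f x) = (\<Sum>k\<leftarrow>ks. \<Sum>w\<leftarrow>ws. f (g k w))"
  by (induction ks) (auto simp: o_def)

lemma finite_histories [simp, intro]: "finite (histories d n)"
  unfolding histories_def using finite_lists_length_eq[of "{..<d}" n]
  by (simp add: conj_commute)

lemma histories_0 [simp]: "histories d 0 = {[]}"
  by (auto simp: histories_def)

lemma sum_histories_Suc:
  fixes f :: "nat list \<Rightarrow> 'a::comm_monoid_add"
  shows "(\<Sum>a\<in>histories d (Suc n). f a) = (\<Sum>p<d. \<Sum>a\<in>histories d n. f (p # a))"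
proof -
  have "histories d (Suc n) = (\<lambda>(p, a). p # a) ` ({..<d} \<times> histories d n)"
    by (auto simp: histories_def length_Suc_conv image_iff)
  moreover have "inj_on (\<lambda>(p, a). p # a) ({..<d} \<times> histories d n)"
    by (auto simp: inj_on_def)
  ultimately have "(\<Sum>a\<in>histories d (Suc n). f a)
      = (\<Sum>x\<in>{..<d} \<times> histories d n. f (case x of (p, a) \<Rightarrow> p # a))"
    by (simp add: sum.reindex o_def)
  also have "\<dots> = (\<Sum>p<d. \<Sum>a\<in>histories d n. f (p # a))"
    by (simp add: sum.cartesian_product case_prod_beta)
  finally show ?thesis .
qed

section \<open>Channels, Kronecker products and partial traces in entries\<close>

lemma apply_kraus_carrier:
  assumes "\<And>K. K \<in> set Ks \<Longrightarrow> K \<in> carrier_mat n m"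
  shows "apply_kraus n Ks R \<in> carrier_mat n n"
proof -
  have "K * R * mat_adjoint K \<in> carrier_mat n n" if "K \<in> set Ks" for K
    using assms[OF that] by (intro carrier_matI) simp_all
  then show ?thesis unfolding apply_kraus_def by (induction Ks) auto
qed

lemma apply_kraus_index:
  assumes Ks: "\<And>K. K \<in> set Ks \<Longrightarrow> K \<in> carrier_mat n m" and R: "R \<in> carrier_mat m m"
    and ij: "i < n" "j < n"
  shows "apply_kraus n Ks R $$ (i, j)
      = (\<Sum>K\<leftarrow>Ks. \<Sum>u<m. \<Sum>v<m. K $$ (i, u) * R $$ (u, v) * cnj (K $$ (j, v)))"
  using Ks
proof (induction Ks)
  case Nil
  then show ?case using ij by (simp add: apply_kraus_def)
next
  case (Cons K Ks)
  have K: "K \<in> carrier_mat n m" using Cons.prems by simp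
  have KR: "K * R \<in> carrier_mat n m" using K R by simp
  have c: "apply_kraus n Ks R \<in> carrier_mat n n"
    using Cons.prems by (intro apply_kraus_carrier) auto
  have "apply_kraus n (K # Ks) R = K * R * mat_adjoint K + apply_kraus n Ks R"
    by (simp add: apply_kraus_def)
  then have "apply_kraus n (K # Ks) R $$ (i, j)
      = (K * R * mat_adjoint K) $$ (i, j) + apply_kraus n Ks R $$ (i, j)"
    using c ij by auto
  also have "(K * R * mat_adjoint K) $$ (i, j) = (\<Sum>v<m. (K * R) $$ (i, v) * mat_adjoint K $$ (v, j))"
    using mat_adjoint_carrier[OF K] KR ij by (intro times_mat_index)
  also have "\<dots> = (\<Sum>v<m. \<Sum>u<m. K $$ (i, u) * R $$ (u, v) * cnj (K $$ (j, v)))"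
    using K ij by (intro sum.cong refl) (simp add: times_mat_index[OF K R] sum_distrib_right)
  also have "\<dots> = (\<Sum>u<m. \<Sum>v<m. K $$ (i, u) * R $$ (u, v) * cnj (K $$ (j, v)))"
    by (rule sum.swap)
  finally show ?case using Cons by simp
qed

lemma kron_carrier: "A \<in> carrier_mat a b \<Longrightarrow> B \<in> carrier_mat c e \<Longrightarrow> kron A B \<in> carrier_mat (a * c) (b * e)"
  by (auto simp: kron_def)

lemma kron_one_index:
  assumes "A \<in> carrier_mat d d" "a < d" "b < d" "w < m" "u < m"
  shows "kron A (1\<^sub>m m) $$ (a * m + w, b * m + u) = (if w = u then A $$ (a, b) else 0)"
  using assms mult_add_less[of a d w m] mult_add_less[of b d u m] by (auto simp: kron_def)

lemma ptrace_first_carrier: "ptrace_first d m X \<in> carrier_mat m m"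
  by (auto simp: ptrace_first_def)

lemma kron_one_times_index:
  assumes A: "A \<in> carrier_mat d d" and X: "X \<in> carrier_mat (d * m) (d * m)"
    and "a < d" "w < m" "y < d * m"
  shows "(kron A (1\<^sub>m m) * X) $$ (a * m + w, y) = (\<Sum>b<d. A $$ (a, b) * X $$ (b * m + w, y))"
proof -
  have "(kron A (1\<^sub>m m) * X) $$ (a * m + w, y)
      = (\<Sum>x<d * m. kron A (1\<^sub>m m) $$ (a * m + w, x) * X $$ (x, y))"
    using assms by (intro times_mat_index[OF kron_carrier[OF A one_carrier_mat] X])
      (auto intro: mult_add_less)
  also have "\<dots> = (\<Sum>b<d. \<Sum>u<m. kron A (1\<^sub>m m) $$ (a * m + w, b * m + u) * X $$ (b * m + u, y))"
    by (rule sum_lessThan_times)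
  also have "\<dots> = (\<Sum>b<d. kron A (1\<^sub>m m) $$ (a * m + w, b * m + w) * X $$ (b * m + w, y))"
    using assms by (intro sum.cong refl sum_lessThan_single) (auto simp: kron_one_index)
  also have "\<dots> = (\<Sum>b<d. A $$ (a, b) * X $$ (b * m + w, y))"
    using assms by (simp add: kron_one_index)
  finally show ?thesis .
qed

lemma ptrace_kron_index:
  assumes A: "A \<in> carrier_mat d d" and X: "X \<in> carrier_mat (d * m) (d * m)" and w: "w < m" "w' < m"
  shows "ptrace_first d m (kron A (1\<^sub>m m) * X) $$ (w, w')
      = (\<Sum>p<d. \<Sum>q<d. A $$ (p, q) * X $$ (q * m + w, p * m + w'))"
  using w by (simp add: ptrace_first_def kron_one_times_index[OF A X] mult_add_less)

text \<open>The entry at row \<open>b\<close> and column \<open>a\<close> of the tensor product of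
  the effects along \<open>h\<close>. All dependence on the device is collected in this
  factor.\<close>

definition path_weight :: "(nat \<Rightarrow> complex mat) \<Rightarrow> nat list \<Rightarrow> nat list \<Rightarrow> nat list \<Rightarrow> complex" where
  "path_weight M h b a = (\<Prod>k<length h. M (h ! k) $$ (b ! k, a ! k))"

lemma path_weight_Cons: "path_weight M (i # h) (p # b) (q # a) = M i $$ (p, q) * path_weight M h b a"
  unfolding path_weight_def by (simp add: prod.lessThan_Suc_shift del: prod.lessThan_Suc)

text \<open>The order of quantifiers is the point: the list \<open>Ws\<close> is chosen before
  \<open>M\<close>, so one list serves the trivial device and every rotated one. The positive
  \<open>\<rho>0\<close> supplies the first rank-one terms, and each query replaces a term by one
  new term per Kraus operator.\<close>

lemma run_path_representation:
  assumes \<rho>: "psd_mat m \<rho>0"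
    and \<Phi>: "\<And>h. length h < T \<Longrightarrow> set h \<subseteq> {..<d} \<Longrightarrow> kraus_channel m (d * m) (\<Phi> h)"
  shows "h \<in> histories d n \<Longrightarrow> n \<le> T \<Longrightarrow>
    \<exists>Ws :: (nat list \<Rightarrow> nat \<Rightarrow> complex) list. \<forall>M. (\<forall>i<d. M i \<in> carrier_mat d d) \<longrightarrow>
      run d m \<rho>0 \<Phi> M h \<in> carrier_mat m m \<and>
      (\<forall>w<m. \<forall>w'<m. run d m \<rho>0 \<Phi> M h $$ (w, w') =
        (\<Sum>W\<leftarrow>Ws. \<Sum>a\<in>histories d n. \<Sum>b\<in>histories d n. path_weight M h b a * (W a w * cnj (W b w'))))"
proof (induction h arbitrary: n)
  case Nil
  then have n: "n = 0" by (simp add: histories_def)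
  obtain ys :: "(nat \<Rightarrow> complex) list" where ys:
    "\<And>i j. i < m \<Longrightarrow> j < m \<Longrightarrow> \<rho>0 $$ (i, j) = (\<Sum>y\<leftarrow>ys. y i * cnj (y j))"
    by (rule psd_mat_rank_one_decomposition[OF \<rho>]) blast
  show ?case
    using \<rho> by (intro exI[of _ "map (\<lambda>y a. y) ys"])
      (simp add: n path_weight_def ys o_def psd_mat_def)
next
  case (Cons i h n')
  then obtain n where n: "n' = Suc n" "h \<in> histories d n" "i < d" "n < T"
    by (auto simp: histories_def)
  then obtain Ws :: "(nat list \<Rightarrow> nat \<Rightarrow> complex) list" where Ws:
    "\<And>M. (\<forall>i<d. M i \<in> carrier_mat d d) \<Longrightarrow> run d m \<rho>0 \<Phi> M h \<in> carrier_mat m m"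
    "\<And>M w w'. (\<forall>i<d. M i \<in> carrier_mat d d) \<Longrightarrow> w < m \<Longrightarrow> w' < m \<Longrightarrow> run d m \<rho>0 \<Phi> M h $$ (w, w') =
        (\<Sum>W\<leftarrow>Ws. \<Sum>a\<in>histories d n. \<Sum>b\<in>histories d n. path_weight M h b a * (W a w * cnj (W b w')))"
    using Cons.IH[of n] by auto
  define Ks where "Ks = \<Phi> h"
  have "kraus_channel m (d * m) Ks"
    unfolding Ks_def using n by (intro \<Phi>) (auto simp: histories_def)
  then have Ks: "\<And>K. K \<in> set Ks \<Longrightarrow> K \<in> carrier_mat (d * m) m" by (simp add: kraus_channel_def)
  \<comment> \<open>The head of the path is the basis index of the C^d register handed to the newest
    query, the tail is the path of the earlier queries; \<open>hd a * m + w\<close> is the encoding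
    used by \<open>kron\<close>.\<close>
  define step where
    "step K W = (\<lambda>a w. \<Sum>u<m. K $$ (hd a * m + w, u) * W (tl a) u)" for K :: "complex mat" and W :: "nat list \<Rightarrow> nat \<Rightarrow> complex"
  show ?case
  proof (intro exI[of _ "concat (map (\<lambda>K. map (step K) Ws) Ks)"] allI impI conjI)
    fix M :: "nat \<Rightarrow> complex mat"
    assume M: "\<forall>i<d. M i \<in> carrier_mat d d"
    show "run d m \<rho>0 \<Phi> M (i # h) \<in> carrier_mat m m" by (simp add: ptrace_first_carrier)
    fix w w' assume w: "w < m" "w' < m"
    define R where "R = run d m \<rho>0 \<Phi> M h"
    have R: "R \<in> carrier_mat m m" using Ws(1)[OF M] by (simp add: R_def)
    define H where "H = histories d n"
    have one: "(\<Sum>u<m. \<Sum>v<m. K $$ (q * m + w, u) * R $$ (u, v) * cnj (K $$ (p * m + w', v)))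
        = (\<Sum>W\<leftarrow>Ws. \<Sum>a\<in>H. \<Sum>b\<in>H. path_weight M h b a * (step K W (q # a) w * cnj (step K W (p # b) w')))"
      for K p q
    proof -
      have "(\<Sum>u<m. \<Sum>v<m. K $$ (q * m + w, u) * R $$ (u, v) * cnj (K $$ (p * m + w', v)))
        = (\<Sum>u<m. \<Sum>v<m. \<Sum>W\<leftarrow>Ws. \<Sum>a\<in>H. \<Sum>b\<in>H. path_weight M h b a *
            ((K $$ (q * m + w, u) * W a u) * (cnj (K $$ (p * m + w', v) * W b v))))"
        by (intro sum.cong refl)
          (simp add: R_def H_def Ws(2)[OF M] sum_distrib_left sum_distrib_right mult_ac
             sum_list_const_mult[symmetric] sum_list_mult_const[symmetric])
      also have "\<dots> = (\<Sum>W\<leftarrow>Ws. \<Sum>u<m. \<Sum>v<m. \<Sum>a\<in>H. \<Sum>b\<in>H. path_weight M h b a *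
            ((K $$ (q * m + w, u) * W a u) * (cnj (K $$ (p * m + w', v) * W b v))))"
        by (simp add: sum_sum_list_swap)
      also have "\<dots> = (\<Sum>W\<leftarrow>Ws. \<Sum>a\<in>H. \<Sum>b\<in>H. \<Sum>u<m. \<Sum>v<m. path_weight M h b a *
            ((K $$ (q * m + w, u) * W a u) * (cnj (K $$ (p * m + w', v) * W b v))))"
        by (subst sum_swap_pairs) (rule refl)
      also have "\<dots> = (\<Sum>W\<leftarrow>Ws. \<Sum>a\<in>H. \<Sum>b\<in>H. path_weight M h b a * (step K W (q # a) w * cnj (step K W (p # b) w')))"
        by (simp add: step_def cnj_sum sum_product) (simp add: sum_distrib_left)
      finally show ?thesis .
    qed
    have Mi: "M i \<in> carrier_mat d d" using M n by blast
    have "run d m \<rho>0 \<Phi> M (i # h) $$ (w, w')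
        = (\<Sum>p<d. \<Sum>q<d. M i $$ (p, q) * apply_kraus (d * m) Ks R $$ (q * m + w, p * m + w'))"
      unfolding run.simps R_def Ks_def
      using Ks w by (intro ptrace_kron_index[OF Mi]) (auto simp: Ks_def intro: apply_kraus_carrier)
    also have "\<dots> = (\<Sum>p<d. \<Sum>q<d. M i $$ (p, q) * (\<Sum>K\<leftarrow>Ks. \<Sum>W\<leftarrow>Ws. \<Sum>a\<in>H. \<Sum>b\<in>H.
         path_weight M h b a * (step K W (q # a) w * cnj (step K W (p # b) w'))))"
      using w by (intro sum.cong refl)
        (simp add: apply_kraus_index[OF Ks R] mult_add_less one)
    also have "\<dots> = (\<Sum>K\<leftarrow>Ks. \<Sum>W\<leftarrow>Ws. \<Sum>p<d. \<Sum>q<d. \<Sum>a\<in>H. \<Sum>b\<in>H.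
         path_weight M (i # h) (p # b) (q # a) * (step K W (q # a) w * cnj (step K W (p # b) w')))"
      by (simp add: path_weight_Cons sum_list_const_mult[symmetric] sum_distrib_left sum_sum_list_swap mult.assoc)
    \<comment> \<open>The sums are regrouped so that \<open>q\<close> stands next to
      \<open>a\<close> and \<open>p\<close> next to \<open>b\<close>; each pair then is a sum over
      paths one step longer.\<close>
    also have "\<dots> = (\<Sum>K\<leftarrow>Ks. \<Sum>W\<leftarrow>Ws. \<Sum>q<d. \<Sum>a\<in>H. \<Sum>p<d. \<Sum>b\<in>H.
         path_weight M (i # h) (p # b) (q # a) * (step K W (q # a) w * cnj (step K W (p # b) w')))"
      (is "(\<Sum>K\<leftarrow>Ks. \<Sum>W\<leftarrow>Ws. ?l K W) = (\<Sum>K\<leftarrow>Ks. \<Sum>W\<leftarrow>Ws. ?r K W)")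
    proof -
      have "?l K W = ?r K W" for K W
        by (subst sum.swap) (intro sum.cong refl sum.swap)
      then show ?thesis by simp
    qed
    also have "\<dots> = (\<Sum>W\<leftarrow>concat (map (\<lambda>K. map (step K) Ws) Ks). \<Sum>a\<in>histories d n'.
        \<Sum>b\<in>histories d n'. path_weight M (i # h) b a * (W a w * cnj (W b w')))"
      by (simp add: sum_list_concat_map_map sum_histories_Suc n H_def)
    finally show "run d m \<rho>0 \<Phi> M (i # h) $$ (w, w') =
        (\<Sum>W\<leftarrow>concat (map (\<lambda>K. map (step K) Ws) Ks). \<Sum>a\<in>histories d n'.
        \<Sum>b\<in>histories d n'. path_weight M (i # h) b a * (W a w * cnj (W b w')))" .
  qed
qed

lemma trace_run_path_representation:
  assumes \<rho>: "psd_mat m \<rho>0"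
    and \<Phi>: "\<And>h. length h < T \<Longrightarrow> set h \<subseteq> {..<d} \<Longrightarrow> kraus_channel m (d * m) (\<Phi> h)"
    and h: "h \<in> histories d T" and G: "psd_mat m G"
  shows "\<exists>vs :: (nat list \<Rightarrow> complex) list. \<forall>M. (\<forall>i<d. M i \<in> carrier_mat d d) \<longrightarrow>
      mtrace (G * run d m \<rho>0 \<Phi> M h) =
      (\<Sum>v\<leftarrow>vs. \<Sum>a\<in>histories d T. \<Sum>b\<in>histories d T. path_weight M h b a * (v a * cnj (v b)))"
proof -
  have Gc: "G \<in> carrier_mat m m" using G by (simp add: psd_mat_def)
  obtain gs :: "(nat \<Rightarrow> complex) list" where gs:
    "\<And>i j. i < m \<Longrightarrow> j < m \<Longrightarrow> G $$ (i, j) = (\<Sum>g\<leftarrow>gs. g i * cnj (g j))"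
    by (rule psd_mat_rank_one_decomposition[OF G]) blast
  obtain Ws :: "(nat list \<Rightarrow> nat \<Rightarrow> complex) list" where Ws:
    "\<And>M. (\<forall>i<d. M i \<in> carrier_mat d d) \<Longrightarrow> run d m \<rho>0 \<Phi> M h \<in> carrier_mat m m"
    "\<And>M w w'. (\<forall>i<d. M i \<in> carrier_mat d d) \<Longrightarrow> w < m \<Longrightarrow> w' < m \<Longrightarrow> run d m \<rho>0 \<Phi> M h $$ (w, w') =
        (\<Sum>W\<leftarrow>Ws. \<Sum>a\<in>histories d T. \<Sum>b\<in>histories d T. path_weight M h b a * (W a w * cnj (W b w')))"
    using run_path_representation[where \<Phi> = \<Phi>, OF \<rho> \<Phi> h order_refl] by blast
  \<comment> \<open>The trace of the product of g g^* with a matrix R is g^* R g, so contracting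
    each \<open>W\<close> with g^* leaves a scalar amplitude for every path.\<close>
  define amp where "amp g W = (\<lambda>a. \<Sum>w<m. cnj (g w) * W a w)" for g :: "nat \<Rightarrow> complex" and W :: "nat list \<Rightarrow> nat \<Rightarrow> complex"
  show ?thesis
  proof (intro exI[of _ "concat (map (\<lambda>g. map (amp g) Ws) gs)"] allI impI)
    fix M :: "nat \<Rightarrow> complex mat"
    assume M: "\<forall>i<d. M i \<in> carrier_mat d d"
    define R where "R = run d m \<rho>0 \<Phi> M h"
    have R: "R \<in> carrier_mat m m" using Ws(1)[OF M] by (simp add: R_def)
    define H where "H = histories d T"
    have "mtrace (G * R) = (\<Sum>w<m. \<Sum>w'<m. G $$ (w, w') * R $$ (w', w))"
      using Gc R by (simp add: mtrace_def times_mat_index[OF Gc R] del: index_mult_mat(1))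
    also have "\<dots> = (\<Sum>w<m. \<Sum>w'<m. \<Sum>g\<leftarrow>gs. \<Sum>W\<leftarrow>Ws. \<Sum>a\<in>H. \<Sum>b\<in>H.
        path_weight M h b a * ((cnj (g w') * W a w') * cnj (cnj (g w) * W b w)))"
      by (intro sum.cong refl)
        (simp add: gs sum_list_mult_const[symmetric],
         simp add: R_def H_def Ws(2)[OF M] sum_distrib_left mult_ac sum_list_const_mult[symmetric])
    also have "\<dots> = (\<Sum>g\<leftarrow>gs. \<Sum>W\<leftarrow>Ws. \<Sum>w<m. \<Sum>w'<m. \<Sum>a\<in>H. \<Sum>b\<in>H.
        path_weight M h b a * ((cnj (g w') * W a w') * cnj (cnj (g w) * W b w)))"
      by (simp only: sum_sum_list_swap)
    also have "\<dots> = (\<Sum>g\<leftarrow>gs. \<Sum>W\<leftarrow>Ws. \<Sum>a\<in>H. \<Sum>b\<in>H. \<Sum>w<m. \<Sum>w'<m.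
        path_weight M h b a * ((cnj (g w') * W a w') * cnj (cnj (g w) * W b w)))"
      by (subst sum_swap_pairs) (rule refl)
    also have "\<dots> = (\<Sum>g\<leftarrow>gs. \<Sum>W\<leftarrow>Ws. \<Sum>a\<in>H. \<Sum>b\<in>H. \<Sum>w'<m. \<Sum>w<m.
        path_weight M h b a * ((cnj (g w') * W a w') * cnj (cnj (g w) * W b w)))"
      (is "(\<Sum>g\<leftarrow>gs. \<Sum>W\<leftarrow>Ws. ?l g W) = (\<Sum>g\<leftarrow>gs. \<Sum>W\<leftarrow>Ws. ?r g W)")
    proof -
      have "?l g W = ?r g W" for g W
        by (intro sum.cong refl sum.swap)
      then show ?thesis by simp
    qed
    also have "\<dots> = (\<Sum>g\<leftarrow>gs. \<Sum>W\<leftarrow>Ws. \<Sum>a\<in>H. \<Sum>b\<in>H. path_weight M h b a * (amp g W a * cnj (amp g W b)))"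
      by (simp add: amp_def cnj_sum sum_product) (simp add: sum_distrib_left)
    finally show "mtrace (G * run d m \<rho>0 \<Phi> M h) =
      (\<Sum>v\<leftarrow>concat (map (\<lambda>g. map (amp g) Ws) gs). \<Sum>a\<in>histories d T. \<Sum>b\<in>histories d T. path_weight M h b a * (v a * cnj (v b)))"
      by (simp add: sum_list_concat_map_map R_def H_def)
  qed
qed

subsection \<open>Normalisation\<close>

lemma mtrace_carrier: "A \<in> carrier_mat n n \<Longrightarrow> mtrace A = (\<Sum>i<n. A $$ (i, i))"
  by (simp add: mtrace_def)

lemma kraus_sum_index:
  assumes "\<And>K. K \<in> set Ks \<Longrightarrow> K \<in> carrier_mat n m" and "u < m" "v < m"
  shows "foldr (\<lambda>K acc. mat_adjoint K * K + acc) Ks (0\<^sub>m m m) \<in> carrier_mat m m"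
    and "foldr (\<lambda>K acc. mat_adjoint K * K + acc) Ks (0\<^sub>m m m) $$ (u, v)
      = (\<Sum>K\<leftarrow>Ks. \<Sum>i<n. cnj (K $$ (i, u)) * K $$ (i, v))"
proof -
  have "foldr (\<lambda>K acc. mat_adjoint K * K + acc) Ks (0\<^sub>m m m) \<in> carrier_mat m m \<and>
      foldr (\<lambda>K acc. mat_adjoint K * K + acc) Ks (0\<^sub>m m m) $$ (u, v)
      = (\<Sum>K\<leftarrow>Ks. \<Sum>i<n. cnj (K $$ (i, u)) * K $$ (i, v))"
    using assms
  proof (induction Ks)
    case (Cons K Ks)
    define S where "S = foldr (\<lambda>K acc. mat_adjoint K * K + acc) Ks (0\<^sub>m m m)"
    have K: "K \<in> carrier_mat n m" using Cons.prems by simp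
    have S: "S \<in> carrier_mat m m" "S $$ (u, v) = (\<Sum>K\<leftarrow>Ks. \<Sum>i<n. cnj (K $$ (i, u)) * K $$ (i, v))"
      using Cons by (auto simp: S_def)
    have KK: "mat_adjoint K * K \<in> carrier_mat m m"
      by (rule mult_carrier_mat[OF mat_adjoint_carrier[OF K] K])
    have "(mat_adjoint K * K + S) $$ (u, v) = (mat_adjoint K * K) $$ (u, v) + S $$ (u, v)"
      using S(1) assms by (intro index_add_mat) auto
    also have "(mat_adjoint K * K) $$ (u, v) = (\<Sum>i<n. mat_adjoint K $$ (u, i) * K $$ (i, v))"
      using assms by (intro times_mat_index[OF mat_adjoint_carrier[OF K] K])
    also have "\<dots> = (\<Sum>i<n. cnj (K $$ (i, u)) * K $$ (i, v))"
      using K assms by (intro sum.cong refl) simp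
    finally show ?case using S KK by (simp add: S_def[symmetric])
  qed (use assms in simp)
  then show "foldr (\<lambda>K acc. mat_adjoint K * K + acc) Ks (0\<^sub>m m m) \<in> carrier_mat m m"
    and "foldr (\<lambda>K acc. mat_adjoint K * K + acc) Ks (0\<^sub>m m m) $$ (u, v)
      = (\<Sum>K\<leftarrow>Ks. \<Sum>i<n. cnj (K $$ (i, u)) * K $$ (i, v))"
    by blast+
qed

lemma mtrace_apply_kraus:
  assumes Ks: "kraus_channel m n Ks" and R: "R \<in> carrier_mat m m"
  shows "mtrace (apply_kraus n Ks R) = mtrace R"
proof -
  have c: "\<And>K. K \<in> set Ks \<Longrightarrow> K \<in> carrier_mat n m" using Ks by (simp add: kraus_channel_def)
  have one: "(\<Sum>K\<leftarrow>Ks. \<Sum>i<n. cnj (K $$ (i, v)) * K $$ (i, u)) = (if v = u then 1 else 0)"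
    if "u < m" "v < m" for u v
    using kraus_sum_index(2)[where Ks = Ks, OF c that(2,1)] Ks that by (simp add: kraus_channel_def)
  have "mtrace (apply_kraus n Ks R)
      = (\<Sum>i<n. \<Sum>K\<leftarrow>Ks. \<Sum>u<m. \<Sum>v<m. K $$ (i, u) * R $$ (u, v) * cnj (K $$ (i, v)))"
    by (simp add: mtrace_carrier[OF apply_kraus_carrier[OF c]] apply_kraus_index[OF c R])
  also have "\<dots> = (\<Sum>K\<leftarrow>Ks. \<Sum>i<n. \<Sum>u<m. \<Sum>v<m. R $$ (u, v) * (cnj (K $$ (i, v)) * K $$ (i, u)))"
    by (simp add: sum_sum_list_swap mult_ac)
  also have "\<dots> = (\<Sum>K\<leftarrow>Ks. \<Sum>u<m. \<Sum>v<m. \<Sum>i<n. R $$ (u, v) * (cnj (K $$ (i, v)) * K $$ (i, u)))"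
    (is "(\<Sum>K\<leftarrow>Ks. ?l K) = (\<Sum>K\<leftarrow>Ks. ?r K)")
  proof -
    have "?l K = ?r K" for K by (subst sum.swap) (intro sum.cong refl sum.swap)
    then show ?thesis by simp
  qed
  also have "\<dots> = (\<Sum>u<m. \<Sum>v<m. \<Sum>K\<leftarrow>Ks. \<Sum>i<n. R $$ (u, v) * (cnj (K $$ (i, v)) * K $$ (i, u)))"
    by (simp only: sum_sum_list_swap)
  also have "\<dots> = (\<Sum>u<m. \<Sum>v<m. R $$ (u, v) * (\<Sum>K\<leftarrow>Ks. \<Sum>i<n. cnj (K $$ (i, v)) * K $$ (i, u)))"
    by (simp only: sum_list_const_mult sum_distrib_left[symmetric])
  also have "\<dots> = (\<Sum>u<m. \<Sum>v<m. R $$ (u, v) * (if v = u then 1 else 0))"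
    by (intro sum.cong refl) (simp add: one)
  also have "\<dots> = (\<Sum>u<m. R $$ (u, u))"
    by (intro sum.cong refl, subst sum_lessThan_single) auto
  finally show ?thesis using R by (simp add: mtrace_carrier)
qed

lemma run_carrier:
  assumes "\<rho>0 \<in> carrier_mat m m"
  shows "run d m \<rho>0 \<Phi> M h \<in> carrier_mat m m"
  using assms by (cases h) (auto simp: ptrace_first_carrier)

lemma mtrace_run_Cons:
  assumes \<Phi>: "kraus_channel m (d * m) (\<Phi> h)" and M: "M i \<in> carrier_mat d d"
  shows "mtrace (run d m \<rho>0 \<Phi> M (i # h))
    = (\<Sum>p<d. \<Sum>q<d. M i $$ (p, q) *
        (\<Sum>w<m. apply_kraus (d * m) (\<Phi> h) (run d m \<rho>0 \<Phi> M h) $$ (q * m + w, p * m + w)))"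
proof -
  define X where "X = apply_kraus (d * m) (\<Phi> h) (run d m \<rho>0 \<Phi> M h)"
  have X: "X \<in> carrier_mat (d * m) (d * m)"
    unfolding X_def using \<Phi> by (intro apply_kraus_carrier) (auto simp: kraus_channel_def)
  have "mtrace (run d m \<rho>0 \<Phi> M (i # h))
      = (\<Sum>w<m. \<Sum>p<d. \<Sum>q<d. M i $$ (p, q) * X $$ (q * m + w, p * m + w))"
    by (simp add: mtrace_carrier[OF ptrace_first_carrier] X_def[symmetric] ptrace_kron_index[OF M X])
  also have "\<dots> = (\<Sum>p<d. \<Sum>q<d. \<Sum>w<m. M i $$ (p, q) * X $$ (q * m + w, p * m + w))"
    by (subst sum.swap) (intro sum.cong refl sum.swap)
  finally show ?thesis by (simp add: X_def sum_distrib_left)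
qed

text \<open>The set \<open>I\<close> and the factor \<open>c\<close> are left open to cover two
  uses: completeness of the effects (all outcomes, \<open>c\<close> = 1) and one outcome of the
  trivial device (a singleton, \<open>c\<close> = 1/d).\<close>

lemma mtrace_run_sum_outcomes:
  assumes \<rho>: "\<rho>0 \<in> carrier_mat m m" and \<Phi>: "kraus_channel m (d * m) (\<Phi> h)"
    and M: "\<And>i. i \<in> I \<Longrightarrow> M i \<in> carrier_mat d d"
    and s: "\<And>p q. p < d \<Longrightarrow> q < d \<Longrightarrow> (\<Sum>i\<in>I. M i $$ (p, q)) = (if p = q then c else 0)"
  shows "(\<Sum>i\<in>I. mtrace (run d m \<rho>0 \<Phi> M (i # h))) = c * mtrace (run d m \<rho>0 \<Phi> M h)"
proof -
  define X where "X = apply_kraus (d * m) (\<Phi> h) (run d m \<rho>0 \<Phi> M h)"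
  have X: "X \<in> carrier_mat (d * m) (d * m)"
    unfolding X_def using \<Phi> by (intro apply_kraus_carrier) (auto simp: kraus_channel_def)
  have "(\<Sum>i\<in>I. mtrace (run d m \<rho>0 \<Phi> M (i # h)))
      = (\<Sum>i\<in>I. \<Sum>p<d. \<Sum>q<d. M i $$ (p, q) * (\<Sum>w<m. X $$ (q * m + w, p * m + w)))"
    by (intro sum.cong refl) (simp add: mtrace_run_Cons[where \<Phi> = \<Phi> and h = h and M = M, OF \<Phi> M] X_def del: run.simps)
  also have "\<dots> = (\<Sum>p<d. \<Sum>q<d. \<Sum>i\<in>I. M i $$ (p, q) * (\<Sum>w<m. X $$ (q * m + w, p * m + w)))"
    by (subst sum.swap) (intro sum.cong refl sum.swap)
  also have "\<dots> = (\<Sum>p<d. \<Sum>q<d. (if p = q then c else 0) * (\<Sum>w<m. X $$ (q * m + w, p * m + w)))"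
    by (intro sum.cong refl) (simp add: sum_distrib_right[symmetric] s)
  also have "\<dots> = (\<Sum>p<d. c * (\<Sum>w<m. X $$ (p * m + w, p * m + w)))"
    by (intro sum.cong refl, subst sum_lessThan_single) auto
  also have "\<dots> = c * mtrace X"
    by (simp add: mtrace_carrier[OF X] sum_lessThan_times sum_distrib_left)
  also have "mtrace X = mtrace (run d m \<rho>0 \<Phi> M h)"
    unfolding X_def by (rule mtrace_apply_kraus[OF \<Phi> run_carrier[OF \<rho>]])
  finally show ?thesis .
qed

lemma sum_mtrace_run:
  assumes \<rho>: "\<rho>0 \<in> carrier_mat m m"
    and \<Phi>: "\<And>h. length h < T \<Longrightarrow> set h \<subseteq> {..<d} \<Longrightarrow> kraus_channel m (d * m) (\<Phi> h)"
    and M: "\<And>i. i < d \<Longrightarrow> M i \<in> carrier_mat d d"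
    and s: "\<And>p q. p < d \<Longrightarrow> q < d \<Longrightarrow> (\<Sum>i<d. M i $$ (p, q)) = (if p = q then 1 else 0)"
  shows "n \<le> T \<Longrightarrow> (\<Sum>h\<in>histories d n. mtrace (run d m \<rho>0 \<Phi> M h)) = mtrace \<rho>0"
proof (induction n)
  case (Suc n)
  have "(\<Sum>h\<in>histories d (Suc n). mtrace (run d m \<rho>0 \<Phi> M h))
      = (\<Sum>h\<in>histories d n. \<Sum>i<d. mtrace (run d m \<rho>0 \<Phi> M (i # h)))"
    unfolding sum_histories_Suc by (rule sum.swap)
  also have "\<dots> = (\<Sum>h\<in>histories d n. 1 * mtrace (run d m \<rho>0 \<Phi> M h))"
    using Suc.prems by (intro sum.cong refl mtrace_run_sum_outcomes \<rho> \<Phi> M s) (auto simp: histories_def)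
  finally show ?case using Suc by simp
qed simp

lemma trivial_povm_carrier: "trivial_povm d i \<in> carrier_mat d d"
  by (simp add: trivial_povm_def)

lemma trivial_povm_index:
  "p < d \<Longrightarrow> q < d \<Longrightarrow> trivial_povm d i $$ (p, q) = (if p = q then 1 / of_nat d else 0)"
  by (simp add: trivial_povm_def)

text \<open>Channels preserve the trace and each trivial effect scales it by 1/d, so the outcomes
  are uniform whatever the protocol does.\<close>

lemma mtrace_run_trivial:
  assumes \<rho>: "\<rho>0 \<in> carrier_mat m m" "mtrace \<rho>0 = 1"
    and \<Phi>: "\<And>h. length h < T \<Longrightarrow> set h \<subseteq> {..<d} \<Longrightarrow> kraus_channel m (d * m) (\<Phi> h)"
  shows "length h \<le> T \<Longrightarrow> set h \<subseteq> {..<d} \<Longrightarrow>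
    mtrace (run d m \<rho>0 \<Phi> (trivial_povm d) h) = 1 / of_nat d ^ length h"
proof (induction h)
  case (Cons i h)
  have "(\<Sum>i\<in>{i}. mtrace (run d m \<rho>0 \<Phi> (trivial_povm d) (i # h)))
      = 1 / of_nat d * mtrace (run d m \<rho>0 \<Phi> (trivial_povm d) h)"
    using Cons.prems
    by (intro mtrace_run_sum_outcomes \<rho> \<Phi>) (auto simp: trivial_povm_carrier trivial_povm_index)
  then show ?case using Cons by simp
qed (use \<rho> in simp)

section \<open>Unitary matrices and the rotated device\<close>

lemma unitary_mat_carrier: "unitary_mat d U \<Longrightarrow> U \<in> carrier_mat d d"
  by (simp add: unitary_mat_def)

lemma unitary_mat_right_inverse:
  assumes "unitary_mat d U"
  shows "U * mat_adjoint U = 1\<^sub>m d"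
  using assms mat_mult_left_right_inverse[OF mat_adjoint_carrier[of U d d], of U]
  by (simp add: unitary_mat_def)

lemma unitary_mat_rows:
  assumes U: "unitary_mat d U" and "p < d" "q < d"
  shows "(\<Sum>i<d. U $$ (p, i) * cnj (U $$ (q, i))) = (if p = q then 1 else 0)"
proof -
  note c = unitary_mat_carrier[OF U]
  have "(U * mat_adjoint U) $$ (p, q) = (\<Sum>i<d. U $$ (p, i) * mat_adjoint U $$ (i, q))"
    using assms by (intro times_mat_index[OF c mat_adjoint_carrier[OF c]])
  also have "\<dots> = (\<Sum>i<d. U $$ (p, i) * cnj (U $$ (q, i)))"
    using c assms by (intro sum.cong refl) simp
  finally show ?thesis using unitary_mat_right_inverse[OF U] assms by simp
qed

lemma unitary_mat_columns:
  assumes U: "unitary_mat d U" and "i < d" "j < d"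
  shows "(\<Sum>p<d. cnj (U $$ (p, i)) * U $$ (p, j)) = (if i = j then 1 else 0)"
proof -
  note c = unitary_mat_carrier[OF U]
  have "(mat_adjoint U * U) $$ (i, j) = (\<Sum>p<d. mat_adjoint U $$ (i, p) * U $$ (p, j))"
    using assms by (intro times_mat_index[OF mat_adjoint_carrier[OF c] c])
  also have "\<dots> = (\<Sum>p<d. cnj (U $$ (p, i)) * U $$ (p, j))"
    using c assms by (intro sum.cong refl) simp
  finally show ?thesis using U assms by (simp add: unitary_mat_def)
qed

lemma unitary_matI:
  assumes c: "U \<in> carrier_mat d d"
    and "\<And>i j. i < d \<Longrightarrow> j < d \<Longrightarrow> (\<Sum>p<d. cnj (U $$ (p, i)) * U $$ (p, j)) = (if i = j then 1 else 0)"
  shows "unitary_mat d U"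
proof -
  have "mat_adjoint U * U = 1\<^sub>m d"
  proof (rule eq_matI)
    fix i j assume "i < dim_row (1\<^sub>m d :: complex mat)" "j < dim_col (1\<^sub>m d :: complex mat)"
    then have ij: "i < d" "j < d" by simp_all
    have "(mat_adjoint U * U) $$ (i, j) = (\<Sum>p<d. mat_adjoint U $$ (i, p) * U $$ (p, j))"
      using ij by (intro times_mat_index[OF mat_adjoint_carrier[OF c] c])
    also have "\<dots> = (\<Sum>p<d. cnj (U $$ (p, i)) * U $$ (p, j))"
      using c ij by (intro sum.cong refl) simp
    finally show "(mat_adjoint U * U) $$ (i, j) = 1\<^sub>m d $$ (i, j)" using ij assms(2) by simp
  qed (use c in auto)
  then show ?thesis using c by (simp add: unitary_mat_def)
qed

lemma rotated_povm_carrier: "U \<in> carrier_mat d d \<Longrightarrow> rotated_povm d U i \<in> carrier_mat d d"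
  unfolding rotated_povm_def by (intro carrier_matI) simp_all

lemma rotated_povm_index:
  assumes U: "U \<in> carrier_mat d d" and "i < d" "p < d" "q < d"
  shows "rotated_povm d U i $$ (p, q) = U $$ (p, i) * cnj (U $$ (q, i))"
proof -
  have B: "basis_proj d i \<in> carrier_mat d d" by (simp add: basis_proj_def)
  have "rotated_povm d U i $$ (p, q)
      = (\<Sum>b<d. (U * basis_proj d i) $$ (p, b) * mat_adjoint U $$ (b, q))"
    unfolding rotated_povm_def using assms
    by (intro times_mat_index[OF mult_carrier_mat[OF U B] mat_adjoint_carrier[OF U]])
  also have "\<dots> = (\<Sum>b<d. (\<Sum>a<d. U $$ (p, a) * basis_proj d i $$ (a, b)) * cnj (U $$ (q, b)))"
    using U assms by (intro sum.cong refl) (simp add: times_mat_index[OF U B] del: index_mult_mat(1))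
  also have "\<dots> = (\<Sum>a<d. U $$ (p, a) * basis_proj d i $$ (a, i)) * cnj (U $$ (q, i))"
    using assms by (intro sum_lessThan_single) (auto simp: basis_proj_def)
  also have "(\<Sum>a<d. U $$ (p, a) * basis_proj d i $$ (a, i)) = U $$ (p, i)"
    using assms by (subst sum_lessThan_single[of i]) (auto simp: basis_proj_def)
  finally show ?thesis .
qed

section \<open>Rejection probabilities\<close>

text \<open>The probability of guess (i). Lower bounds on Haar averages of positive terms become
  upper bounds on the success probability only when applied to this guess under scenario
  (ii).\<close>

definition reject_prob ::
  "nat \<Rightarrow> nat \<Rightarrow> nat \<Rightarrow> complex mat \<Rightarrow> (nat list \<Rightarrow> complex mat list) \<Rightarrow> (nat list \<Rightarrow> complex mat)
     \<Rightarrow> (nat \<Rightarrow> complex mat) \<Rightarrow> real" where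
  "reject_prob d m T \<rho>0 \<Phi> F M = (\<Sum>h\<in>histories d T. Re (mtrace ((1\<^sub>m m - F h) * run d m \<rho>0 \<Phi> M h)))"

lemma mtrace_complement_times:
  assumes F: "F \<in> carrier_mat m m" and R: "R \<in> carrier_mat m m"
  shows "mtrace ((1\<^sub>m m - F) * R) = mtrace R - mtrace (F * R)"
proof -
  have "(1\<^sub>m m - F) * R = R - F * R"
    using minus_mult_distrib_mat[OF one_carrier_mat F R] R by simp
  moreover have "mtrace (R - F * R) = mtrace R - mtrace (F * R)"
    using F R by (simp add: mtrace_def sum_subtractf del: index_mult_mat(1))
  ultimately show ?thesis by simp
qed

lemma accept_prob_eq:
  assumes v: "valid_protocol d m T \<rho>0 \<Phi> F"
    and M: "\<And>i. i < d \<Longrightarrow> M i \<in> carrier_mat d d"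
    and s: "\<And>p q. p < d \<Longrightarrow> q < d \<Longrightarrow> (\<Sum>i<d. M i $$ (p, q)) = (if p = q then 1 else 0)"
  shows "accept_prob d m T \<rho>0 \<Phi> F M = 1 - reject_prob d m T \<rho>0 \<Phi> F M"
proof -
  have \<rho>: "\<rho>0 \<in> carrier_mat m m" "mtrace \<rho>0 = 1"
    using v by (auto simp: valid_protocol_def density_mat_def psd_mat_def)
  have F: "F h \<in> carrier_mat m m" if "h \<in> histories d T" for h
    using v that by (auto simp: valid_protocol_def psd_mat_def histories_def)
  have "(\<Sum>h\<in>histories d T. mtrace (run d m \<rho>0 \<Phi> M h)) = 1"
    using v \<rho> by (subst sum_mtrace_run[OF \<rho>(1) _ M s, where T = T]) (auto simp: valid_protocol_def)
  moreover have "reject_prob d m T \<rho>0 \<Phi> F M = Re (\<Sum>h\<in>histories d T. mtrace (run d m \<rho>0 \<Phi> M h))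
      - Re (\<Sum>h\<in>histories d T. mtrace (F h * run d m \<rho>0 \<Phi> M h))"
    unfolding reject_prob_def
    by (simp add: mtrace_complement_times[OF F run_carrier[OF \<rho>(1)]] sum_subtractf)
  ultimately show ?thesis by (simp add: accept_prob_def)
qed

subsection \<open>Haar integration\<close>

lemma unitary_generator_Pow:
  "{{U. unitary_mat d U \<and> U $$ (i, j) \<in> B} | i j B. i < d \<and> j < d \<and> B \<in> sets borel} \<subseteq> Pow {U. unitary_mat d U}"
  by auto

lemma space_unitary_space [simp]: "space (unitary_space d) = {U. unitary_mat d U}"
  unfolding unitary_space_def by (rule space_measure_of[OF unitary_generator_Pow])

lemma measurable_unitary_entry:
  assumes "i < d" "j < d"
  shows "(\<lambda>U. U $$ (i, j)) \<in> borel_measurable (unitary_space d)"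
proof (rule measurableI)
  fix B :: "complex set" assume B: "B \<in> sets borel"
  have "(\<lambda>U. U $$ (i, j)) -` B \<inter> space (unitary_space d) = {U. unitary_mat d U \<and> U $$ (i, j) \<in> B}"
    by auto
  also have "\<dots> \<in> sets (unitary_space d)"
    unfolding unitary_space_def sets_measure_of[OF unitary_generator_Pow]
    using assms B by (intro sigma_sets.Basic) blast
  finally show "(\<lambda>U. U $$ (i, j)) -` B \<inter> space (unitary_space d) \<in> sets (unitary_space d)" .
qed simp

text \<open>The sigma-algebra is generated by the entries, so measurability into it can be checked
  entry by entry.\<close>

lemma measurable_into_unitary_space:
  assumes f: "\<And>x. x \<in> space N \<Longrightarrow> unitary_mat d (f x)"
    and e: "\<And>i j. i < d \<Longrightarrow> j < d \<Longrightarrow> (\<lambda>x. f x $$ (i, j)) \<in> borel_measurable N"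
  shows "f \<in> measurable N (unitary_space d)"
  unfolding unitary_space_def
proof (rule measurable_measure_of[OF unitary_generator_Pow])
  show "f \<in> space N \<rightarrow> {U. unitary_mat d U}" using f by auto
  fix Y assume "Y \<in> {{U. unitary_mat d U \<and> U $$ (i, j) \<in> B} | i j B. i < d \<and> j < d \<and> B \<in> sets borel}"
  then obtain i j B where Y: "Y = {U. unitary_mat d U \<and> U $$ (i, j) \<in> B}" "i < d" "j < d" "B \<in> sets borel"
    by blast
  have "f -` Y \<inter> space N = (\<lambda>x. f x $$ (i, j)) -` B \<inter> space N"
    using f by (auto simp: Y)
  then show "f -` Y \<inter> space N \<in> sets N" using measurable_sets[OF e[OF Y(2,3)] Y(4)] by simp
qed

lemma unitary_mat_times:
  assumes V: "unitary_mat d V" and U: "unitary_mat d U"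
  shows "unitary_mat d (V * U)"
proof (rule unitary_matI)
  note c = unitary_mat_carrier[OF V] unitary_mat_carrier[OF U]
  show "V * U \<in> carrier_mat d d" using c by (rule mult_carrier_mat)
  fix i j assume ij: "i < d" "j < d"
  have "(\<Sum>p<d. cnj ((V * U) $$ (p, i)) * (V * U) $$ (p, j))
      = (\<Sum>p<d. \<Sum>a<d. \<Sum>b<d. (cnj (U $$ (a, i)) * U $$ (b, j)) * (cnj (V $$ (p, a)) * V $$ (p, b)))"
    using ij by (intro sum.cong refl)
      (simp add: times_mat_index[OF c] cnj_sum sum_product del: index_mult_mat(1), simp add: mult_ac)
  also have "\<dots> = (\<Sum>a<d. \<Sum>b<d. \<Sum>p<d. (cnj (U $$ (a, i)) * U $$ (b, j)) * (cnj (V $$ (p, a)) * V $$ (p, b)))"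
    by (subst sum.swap) (intro sum.cong refl sum.swap)
  also have "\<dots> = (\<Sum>a<d. \<Sum>b<d. (cnj (U $$ (a, i)) * U $$ (b, j)) * (if a = b then 1 else 0))"
    by (intro sum.cong refl) (simp add: sum_distrib_left[symmetric] unitary_mat_columns[OF V])
  also have "\<dots> = (\<Sum>a<d. cnj (U $$ (a, i)) * U $$ (a, j))"
    by (intro sum.cong refl, subst sum_lessThan_single) auto
  finally show "(\<Sum>p<d. cnj ((V * U) $$ (p, i)) * (V * U) $$ (p, j)) = (if i = j then 1 else 0)"
    using ij by (simp add: unitary_mat_columns[OF U])
qed

lemma unitary_mat_adjoint:
  assumes U: "unitary_mat d U"
  shows "unitary_mat d (mat_adjoint U)"
proof (rule unitary_matI)
  note c = unitary_mat_carrier[OF U]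
  show "mat_adjoint U \<in> carrier_mat d d" using c by (rule mat_adjoint_carrier)
  fix i j assume ij: "i < d" "j < d"
  have "(\<Sum>p<d. cnj (mat_adjoint U $$ (p, i)) * mat_adjoint U $$ (p, j))
      = (\<Sum>p<d. U $$ (i, p) * cnj (U $$ (j, p)))"
    using ij c by (intro sum.cong refl) simp
  then show "(\<Sum>p<d. cnj (mat_adjoint U $$ (p, i)) * mat_adjoint U $$ (p, j)) = (if i = j then 1 else 0)"
    using ij by (simp add: unitary_mat_rows[OF U])
qed

lemma mat_adjoint_times:
  fixes A B :: "complex mat"
  assumes A: "A \<in> carrier_mat n k" and B: "B \<in> carrier_mat k m"
  shows "mat_adjoint (A * B) = mat_adjoint B * mat_adjoint A"
proof (rule eq_matI)
  show "dim_row (mat_adjoint (A * B)) = dim_row (mat_adjoint B * mat_adjoint A)"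
    "dim_col (mat_adjoint (A * B)) = dim_col (mat_adjoint B * mat_adjoint A)" using A B by simp_all
  fix i j assume "i < dim_row (mat_adjoint B * mat_adjoint A)" "j < dim_col (mat_adjoint B * mat_adjoint A)"
  then have ij: "i < m" "j < n" using A B by simp_all
  have "(mat_adjoint B * mat_adjoint A) $$ (i, j) = (\<Sum>l<k. mat_adjoint B $$ (i, l) * mat_adjoint A $$ (l, j))"
    using ij by (intro times_mat_index[OF mat_adjoint_carrier[OF B] mat_adjoint_carrier[OF A]])
  also have "\<dots> = cnj (\<Sum>l<k. A $$ (j, l) * B $$ (l, i))"
    unfolding cnj_sum using ij A B by (intro sum.cong refl) simp
  also have "\<dots> = cnj ((A * B) $$ (j, i))"
    using ij by (simp add: times_mat_index[OF A B] del: index_mult_mat(1))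
  also have "\<dots> = mat_adjoint (A * B) $$ (i, j)"
    using ij A B by (simp del: index_mult_mat(1))
  finally show "mat_adjoint (A * B) $$ (i, j) = (mat_adjoint B * mat_adjoint A) $$ (i, j)" by simp
qed

lemma mat_adjoint_adjoint: "mat_adjoint (mat_adjoint A) = (A :: complex mat)"
  by (rule eq_matI) simp_all

lemma unitary_mat_entry_le:
  assumes U: "unitary_mat d U" and "p < d" "i < d"
  shows "cmod (U $$ (p, i)) \<le> 1"
proof -
  have "complex_of_real (\<Sum>p<d. (cmod (U $$ (p, i)))\<^sup>2) = (\<Sum>p<d. cnj (U $$ (p, i)) * U $$ (p, i))"
    unfolding of_real_sum by (intro sum.cong refl) (metis complex_norm_square mult.commute of_real_power)
  also have "\<dots> = 1" using assms by (simp add: unitary_mat_columns[OF U])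
  finally have "(\<Sum>p<d. (cmod (U $$ (p, i)))\<^sup>2) = 1" using of_real_eq_1_iff by blast
  moreover have "(cmod (U $$ (p, i)))\<^sup>2 \<le> (\<Sum>p<d. (cmod (U $$ (p, i)))\<^sup>2)"
    using assms by (intro member_le_sum) auto
  ultimately have "(cmod (U $$ (p, i)))\<^sup>2 \<le> 1\<^sup>2" by simp
  then show ?thesis by (rule power2_le_imp_le) simp
qed

locale haar =
  fixes d :: nat and \<mu> :: "complex mat measure"
  assumes haar: "haar_measure d \<mu>"
begin

sublocale prob_space \<mu> using haar by (simp add: haar_measure_def)

lemma sets_haar: "sets \<mu> = sets (unitary_space d)"
  using haar by (simp add: haar_measure_def)

lemma space_haar: "space \<mu> = {U. unitary_mat d U}"
  using sets_eq_imp_space_eq[OF sets_haar] by simp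

lemma measurable_entry: "i < d \<Longrightarrow> j < d \<Longrightarrow> (\<lambda>U. U $$ (i, j)) \<in> borel_measurable \<mu>"
  using measurable_unitary_entry measurable_cong_sets[OF sets_haar refl] by blast

lemma measurable_into_haar:
  assumes "\<And>x. x \<in> space N \<Longrightarrow> unitary_mat d (f x)"
    and "\<And>i j. i < d \<Longrightarrow> j < d \<Longrightarrow> (\<lambda>x. f x $$ (i, j)) \<in> borel_measurable N"
  shows "f \<in> measurable N \<mu>"
  using measurable_into_unitary_space[OF assms] measurable_cong_sets[OF refl sets_haar] by blast

lemma measurable_left_mult:
  assumes V: "unitary_mat d V"
  shows "(\<lambda>U. V * U) \<in> measurable \<mu> \<mu>"
proof (rule measurable_into_haar)
  fix U assume "U \<in> space \<mu>"
  then show "unitary_mat d (V * U)" using V by (simp add: space_haar unitary_mat_times)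
next
  fix i j assume ij: "i < d" "j < d"
  have "(\<lambda>U. (V * U) $$ (i, j)) \<in> borel_measurable \<mu> \<longleftrightarrow>
      (\<lambda>U. \<Sum>l<d. V $$ (i, l) * U $$ (l, j)) \<in> borel_measurable \<mu>"
    by (intro measurable_cong times_mat_index[of _ d d _ d])
      (use ij V in \<open>simp_all add: space_haar unitary_mat_carrier\<close>)
  then show "(\<lambda>U. (V * U) $$ (i, j)) \<in> borel_measurable \<mu>"
    using ij by (auto intro!: borel_measurable_sum borel_measurable_times measurable_entry)
qed

lemma integral_left_mult:
  fixes f :: "complex mat \<Rightarrow> 'b::{banach, second_countable_topology}"
  assumes V: "unitary_mat d V" and f: "f \<in> borel_measurable \<mu>"
  shows "(\<integral>U. f (V * U) \<partial>\<mu>) = (\<integral>U. f U \<partial>\<mu>)"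
proof -
  have "(\<integral>U. f U \<partial>\<mu>) = (\<integral>U. f U \<partial>distr \<mu> \<mu> (\<lambda>U. V * U))"
    using haar V by (simp add: haar_measure_def)
  also have "\<dots> = (\<integral>U. f (V * U) \<partial>\<mu>)"
    by (rule integral_distr[OF measurable_left_mult[OF V] f])
  finally show ?thesis by simp
qed

lemma integrable_haar:
  fixes f :: "complex mat \<Rightarrow> 'b::{banach, second_countable_topology}"
  assumes f: "f \<in> borel_measurable \<mu>" and b: "\<And>U. unitary_mat d U \<Longrightarrow> norm (f U) \<le> B"
  shows "integrable \<mu> f"
  by (rule integrable_const_bound[of _ B]) (use f b in \<open>auto simp: space_haar\<close>)

text \<open>Joint measurability in both unitaries is what the exchange of the two Haar integrals
  requires.\<close>

lemma measurable_adjoint_mult: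
  "(\<lambda>(X, U). mat_adjoint X * U) \<in> measurable (\<mu> \<Otimes>\<^sub>M \<mu>) \<mu>"
proof (rule measurable_into_haar)
  fix x assume "x \<in> space (\<mu> \<Otimes>\<^sub>M \<mu>)"
  then show "unitary_mat d (case x of (X, U) \<Rightarrow> mat_adjoint X * U)"
    by (auto simp: space_pair_measure space_haar unitary_mat_times unitary_mat_adjoint)
next
  fix i j assume ij: "i < d" "j < d"
  have "(\<lambda>x. (case x of (X, U) \<Rightarrow> mat_adjoint X * U) $$ (i, j)) \<in> borel_measurable (\<mu> \<Otimes>\<^sub>M \<mu>) \<longleftrightarrow>
      (\<lambda>x. \<Sum>l<d. cnj (fst x $$ (l, i)) * snd x $$ (l, j)) \<in> borel_measurable (\<mu> \<Otimes>\<^sub>M \<mu>)"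
  proof (rule measurable_cong)
    fix x assume "x \<in> space (\<mu> \<Otimes>\<^sub>M \<mu>)"
    then obtain X U where x: "x = (X, U)" "unitary_mat d X" "unitary_mat d U"
      by (auto simp: space_pair_measure space_haar)
    note c = unitary_mat_carrier[OF x(2)] unitary_mat_carrier[OF x(3)]
    have "(mat_adjoint X * U) $$ (i, j) = (\<Sum>l<d. mat_adjoint X $$ (i, l) * U $$ (l, j))"
      using ij by (intro times_mat_index[OF mat_adjoint_carrier[OF c(1)] c(2)])
    also have "\<dots> = (\<Sum>l<d. cnj (X $$ (l, i)) * U $$ (l, j))"
      using ij c by (intro sum.cong refl) simp
    finally show "(case x of (X, U) \<Rightarrow> mat_adjoint X * U) $$ (i, j)
        = (\<Sum>l<d. cnj (fst x $$ (l, i)) * snd x $$ (l, j))" by (simp add: x)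
  qed
  moreover have "(\<lambda>x. \<Sum>l<d. cnj (fst x $$ (l, i)) * snd x $$ (l, j)) \<in> borel_measurable (\<mu> \<Otimes>\<^sub>M \<mu>)"
  proof (intro borel_measurable_sum borel_measurable_times)
    fix l assume "l \<in> {..<d}"
    then have l: "l < d" by simp
    show "(\<lambda>x. cnj (fst x $$ (l, i))) \<in> borel_measurable (\<mu> \<Otimes>\<^sub>M \<mu>)"
      by (intro measurable_compose[OF measurable_compose[OF measurable_fst measurable_entry[OF l ij(1)]]]
          borel_measurable_continuous_onI continuous_intros)
    show "(\<lambda>x. snd x $$ (l, j)) \<in> borel_measurable (\<mu> \<Otimes>\<^sub>M \<mu>)"
      by (rule measurable_compose[OF measurable_snd measurable_entry[OF l ij(2)]])
  qed
  ultimately show "(\<lambda>x. (case x of (X, U) \<Rightarrow> mat_adjoint X * U) $$ (i, j)) \<in> borel_measurable (\<mu> \<Otimes>\<^sub>M \<mu>)"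
    by simp
qed

text \<open>Averaging the left invariance over the translations \<open>X\<^sup>*\<close> with \<open>X\<close> Haar random, and then using left
  invariance in \<open>X\<close>, gives invariance under inversion and so right invariance.\<close>

lemma integral_adjoint:
  fixes f :: "complex mat \<Rightarrow> real"
  assumes f: "f \<in> borel_measurable \<mu>" and b: "\<And>U. unitary_mat d U \<Longrightarrow> norm (f U) \<le> B"
  shows "(\<integral>X. f (mat_adjoint X) \<partial>\<mu>) = (\<integral>U. f U \<partial>\<mu>)"
proof -
  have total: "measure \<mu> (space \<mu>) = 1" by (rule prob_space)
  interpret pair_prob_space \<mu> \<mu> by unfold_locales
  have fm: "(\<lambda>(X, U). f (mat_adjoint X * U)) \<in> borel_measurable (\<mu> \<Otimes>\<^sub>M \<mu>)"
    using measurable_compose[OF measurable_adjoint_mult f] by (simp add: case_prod_beta)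
  have int: "integrable (\<mu> \<Otimes>\<^sub>M \<mu>) (\<lambda>(X, U). f (mat_adjoint X * U))"
    by (rule P.integrable_const_bound[of _ B])
      (use fm b in \<open>auto simp: space_pair_measure space_haar unitary_mat_times unitary_mat_adjoint\<close>)
  have one: "(\<integral>X. f (mat_adjoint X * U) \<partial>\<mu>) = (\<integral>X. f (mat_adjoint X) \<partial>\<mu>)"
    if U: "unitary_mat d U" for U
  proof -
    have "(\<lambda>X. f (mat_adjoint X * U)) \<in> borel_measurable \<mu>"
      using measurable_compose[OF measurable_Pair2' fm, of U] U by (simp add: space_haar)
    then have "(\<integral>X. f (mat_adjoint X * U) \<partial>\<mu>) = (\<integral>X. f (mat_adjoint (U * X) * U) \<partial>\<mu>)"
      by (rule integral_left_mult[OF U, symmetric])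
    also have "\<dots> = (\<integral>X. f (mat_adjoint X) \<partial>\<mu>)"
    proof (rule Bochner_Integration.integral_cong[OF refl])
      fix X assume "X \<in> space \<mu>"
      then have X: "X \<in> carrier_mat d d" by (simp add: space_haar unitary_mat_carrier)
      have Uc: "U \<in> carrier_mat d d" by (rule unitary_mat_carrier[OF U])
      have "mat_adjoint (U * X) * U = mat_adjoint X * (mat_adjoint U * U)"
        unfolding mat_adjoint_times[OF Uc X]
        by (rule assoc_mult_mat[OF mat_adjoint_carrier[OF X] mat_adjoint_carrier[OF Uc] Uc])
      also have "\<dots> = mat_adjoint X"
        using U by (simp add: unitary_mat_def right_mult_one_mat[OF mat_adjoint_carrier[OF X]])
      finally show "f (mat_adjoint (U * X) * U) = f (mat_adjoint X)" by simp
    qed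
    finally show ?thesis .
  qed
  have "(\<integral>U. f U \<partial>\<mu>) = (\<integral>X. (\<integral>U. f U \<partial>\<mu>) \<partial>\<mu>)" by (simp add: total)
  also have "\<dots> = (\<integral>X. (\<integral>U. f (mat_adjoint X * U) \<partial>\<mu>) \<partial>\<mu>)"
    by (intro Bochner_Integration.integral_cong refl integral_left_mult[symmetric] f)
      (simp add: space_haar unitary_mat_adjoint)
  also have "\<dots> = (\<integral>U. (\<integral>X. f (mat_adjoint X * U) \<partial>\<mu>) \<partial>\<mu>)"
    by (rule Fubini_integral[OF int, symmetric])
  also have "\<dots> = (\<integral>U. (\<integral>X. f (mat_adjoint X) \<partial>\<mu>) \<partial>\<mu>)"
    by (intro Bochner_Integration.integral_cong refl one) (simp add: space_haar)
  also have "\<dots> = (\<integral>X. f (mat_adjoint X) \<partial>\<mu>)" by (simp add: total)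
  finally show ?thesis by simp
qed

text \<open>Taking adjoints turns right translation by \<open>W\<close> into left translation by
  \<open>mat_adjoint W\<close>, and the integral does not change under adjoints.\<close>

lemma integral_right_mult:
  fixes f :: "complex mat \<Rightarrow> real"
  assumes f: "f \<in> borel_measurable \<mu>" and b: "\<And>U. unitary_mat d U \<Longrightarrow> norm (f U) \<le> B"
    and W: "unitary_mat d W" and fW: "(\<lambda>U. f (U * W)) \<in> borel_measurable \<mu>"
  shows "(\<integral>U. f (U * W) \<partial>\<mu>) = (\<integral>U. f U \<partial>\<mu>)"
proof -
  have Wc: "W \<in> carrier_mat d d" by (rule unitary_mat_carrier[OF W])
  \<comment> \<open>Measurability of the adjoint is read off the joint map by fixing its second
    argument to the identity.\<close>
  have "(\<lambda>X. (mat_adjoint X * 1\<^sub>m d) ) \<in> measurable \<mu> \<mu>"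
  proof -
    have "unitary_mat d (1\<^sub>m d)" by (rule unitary_matI) (auto simp: sum_lessThan_single)
    then show ?thesis
      using measurable_compose[OF measurable_Pair2' measurable_adjoint_mult, of "1\<^sub>m d"]
      by (simp add: space_haar)
  qed
  moreover have "mat_adjoint X * 1\<^sub>m d = mat_adjoint X" if "X \<in> space \<mu>" for X
    using that mat_adjoint_carrier[of X d d] by (auto simp: space_haar dest: unitary_mat_carrier)
  ultimately have "mat_adjoint \<in> measurable \<mu> \<mu>"
    by (subst (asm) measurable_cong) auto
  then have am: "(\<lambda>X. f (mat_adjoint X)) \<in> borel_measurable \<mu>"
    using measurable_compose f by blast
  have "(\<integral>U. f (U * W) \<partial>\<mu>) = (\<integral>X. f (mat_adjoint X * W) \<partial>\<mu>)"
    using W by (intro integral_adjoint[OF fW, of B, symmetric] b) (simp add: unitary_mat_times)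
  also have "\<dots> = (\<integral>X. f (mat_adjoint (mat_adjoint W * X)) \<partial>\<mu>)"
    by (intro Bochner_Integration.integral_cong refl)
      (simp add: space_haar mat_adjoint_times[OF mat_adjoint_carrier[OF Wc] unitary_mat_carrier] mat_adjoint_adjoint)
  also have "\<dots> = (\<integral>X. f (mat_adjoint X) \<partial>\<mu>)"
    by (rule integral_left_mult[OF unitary_mat_adjoint[OF W] am])
  also have "\<dots> = (\<integral>U. f U \<partial>\<mu>)" by (rule integral_adjoint[OF f b])
  finally show ?thesis .
qed

end

subsection \<open>Second moments\<close>

context haar
begin

text \<open>These are the only monomials whose Haar averages are computed. The row indices
  \<open>p\<close>, \<open>q\<close> belong to conjugated entries, \<open>r\<close>,
  \<open>s\<close> to plain ones, and all four entries lie in column \<open>i\<close>.\<close>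

definition quartic :: "nat \<Rightarrow> nat \<Rightarrow> nat \<Rightarrow> nat \<Rightarrow> nat \<Rightarrow> complex mat \<Rightarrow> complex" where
  "quartic i p q r s U = cnj (U $$ (p, i)) * cnj (U $$ (q, i)) * (U $$ (r, i) * U $$ (s, i))"

lemma measurable_cnj_entry: "i < d \<Longrightarrow> j < d \<Longrightarrow> (\<lambda>U. cnj (U $$ (i, j))) \<in> borel_measurable \<mu>"
  by (intro measurable_compose[OF measurable_entry] borel_measurable_continuous_onI continuous_intros)

lemma measurable_quartic:
  assumes "i < d" "p < d" "q < d" "r < d" "s < d"
  shows "quartic i p q r s \<in> borel_measurable \<mu>"
  unfolding quartic_def[abs_def] using assms
  by (intro borel_measurable_times measurable_entry measurable_cnj_entry)

lemma integrable_quartic [simp]: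
  assumes "i < d" "p < d" "q < d" "r < d" "s < d"
  shows "integrable \<mu> (quartic i p q r s)"
proof (rule integrable_haar[OF measurable_quartic[OF assms], of 1])
  fix U assume U: "unitary_mat d U"
  note le = unitary_mat_entry_le[OF U _ assms(1)]
  have "norm (quartic i p q r s U) = (cmod (U $$ (p, i)) * cmod (U $$ (q, i))) * (cmod (U $$ (r, i)) * cmod (U $$ (s, i)))"
    by (simp add: quartic_def norm_mult)
  also have "\<dots> \<le> (1 * 1) * (1 * 1)"
    using assms by (intro mult_mono le) auto
  finally show "norm (quartic i p q r s U) \<le> 1" by simp
qed

definition moment :: "nat \<Rightarrow> nat \<Rightarrow> nat \<Rightarrow> nat \<Rightarrow> nat \<Rightarrow> complex" where
  "moment i p q r s = (\<integral>U. quartic i p q r s U \<partial>\<mu>)"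

text \<open>In a quartic monomial the index \<open>t\<close> occurs with net exponent between -2 and
  2, and in this range \<i>^n = 1 only for n = 0. The single phase \<i> therefore detects every
  imbalance.\<close>

definition phase_mat :: "nat \<Rightarrow> complex mat" where
  "phase_mat t = mat d d (\<lambda>(a, b). if a = b then (if a = t then \<i> else 1) else 0)"

lemma phase_mat_carrier: "phase_mat t \<in> carrier_mat d d"
  by (simp add: phase_mat_def)

lemma unitary_phase_mat: "unitary_mat d (phase_mat t)"
proof (rule unitary_matI[OF phase_mat_carrier])
  fix i j assume ij: "i < d" "j < d"
  then have "(\<Sum>p<d. cnj (phase_mat t $$ (p, i)) * phase_mat t $$ (p, j))
      = cnj (phase_mat t $$ (i, i)) * phase_mat t $$ (i, j)"
    by (intro sum_lessThan_single) (auto simp: phase_mat_def)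
  then show "(\<Sum>p<d. cnj (phase_mat t $$ (p, i)) * phase_mat t $$ (p, j)) = (if i = j then 1 else 0)"
    using ij by (auto simp: phase_mat_def)
qed

lemma phase_mat_times_index:
  assumes U: "unitary_mat d U" and "p < d" "i < d"
  shows "(phase_mat t * U) $$ (p, i) = (if p = t then \<i> else 1) * U $$ (p, i)"
proof -
  have "(phase_mat t * U) $$ (p, i) = (\<Sum>l<d. phase_mat t $$ (p, l) * U $$ (l, i))"
    using assms by (intro times_mat_index[OF phase_mat_carrier unitary_mat_carrier[OF U]])
  also have "\<dots> = phase_mat t $$ (p, p) * U $$ (p, i)"
    using assms by (intro sum_lessThan_single) (auto simp: phase_mat_def)
  finally show ?thesis using assms by (simp add: phase_mat_def)
qed

lemma moment_phase:
  assumes "i < d" "p < d" "q < d" "r < d" "s < d"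
  shows "moment i p q r s = (cnj (if p = t then \<i> else 1) * cnj (if q = t then \<i> else 1) *
     ((if r = t then \<i> else 1) * (if s = t then \<i> else 1))) * moment i p q r s"
    (is "_ = ?c * _")
proof -
  have "moment i p q r s = (\<integral>U. quartic i p q r s (phase_mat t * U) \<partial>\<mu>)"
    unfolding moment_def
    by (rule integral_left_mult[OF unitary_phase_mat measurable_quartic[OF assms], symmetric])
  also have "\<dots> = (\<integral>U. ?c * quartic i p q r s U \<partial>\<mu>)"
    unfolding quartic_def using assms
    by (intro Bochner_Integration.integral_cong refl)
      (simp only: space_haar mem_Collect_eq phase_mat_times_index complex_cnj_mult mult_ac)
  also have "\<dots> = ?c * moment i p q r s"
    unfolding moment_def by (rule integral_mult_right_zero)
  finally show ?thesis .
qed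

text \<open>If {p, q} and {r, s} differ as multisets, some index \<open>t\<close> among them is
  unbalanced; the phase at \<open>t\<close> then multiplies the moment by a number other than 1
  without changing it.\<close>

lemma moment_eq_0:
  assumes b: "i < d" "p < d" "q < d" "r < d" "s < d"
    and ne: "\<not> (p = r \<and> q = s)" "\<not> (p = s \<and> q = r)"
  shows "moment i p q r s = 0"
proof -
  define c where "c t = cnj (if p = t then \<i> else 1) * cnj (if q = t then \<i> else 1) *
     ((if r = t then \<i> else 1) * (if s = t then \<i> else 1))" for t
  have "c p \<noteq> 1 \<or> c q \<noteq> 1 \<or> c r \<noteq> 1 \<or> c s \<noteq> 1"
    using ne by (auto simp: c_def complex_eq_iff split: if_splits)
  then obtain t where "c t \<noteq> 1" by blast
  moreover have "moment i p q r s = c t * moment i p q r s"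
    unfolding c_def by (rule moment_phase[OF b])
  ultimately show ?thesis by (metis mult_cancel_right1)
qed

text \<open>The Householder reflection along \<open>e\<^sub>p + 2 e\<^sub>q\<close>; it mixes the two coordinates with the
  rational coefficients \<open>3/5\<close> and \<open>4/5\<close>.\<close>

definition reflection_mat :: "nat \<Rightarrow> nat \<Rightarrow> complex mat" where
  "reflection_mat p q = mat d d (\<lambda>(a, b). (if a = b then 1 else 0) -
     2 / 5 * ((if a = p then 1 else if a = q then 2 else 0) * (if b = p then 1 else if b = q then 2 else 0)))"

lemma reflection_mat_carrier: "reflection_mat p q \<in> carrier_mat d d"
  by (simp add: reflection_mat_def)

lemma sum_two_points:
  fixes g :: "nat \<Rightarrow> complex"
  assumes "p < d" "q < d" "p \<noteq> q"
  shows "(\<Sum>a<d. (if a = p then 1 else if a = q then 2 else 0) * g a) = g p + 2 * g q"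
proof -
  have "(\<Sum>a<d. (if a = p then 1 else if a = q then 2 else 0) * g a)
      = (\<Sum>a\<in>{p, q}. (if a = p then 1 else if a = q then 2 else 0) * g a)"
    using assms by (intro sum.mono_neutral_right) auto
  then show ?thesis using assms by simp
qed

lemma sum_reflection_row:
  fixes g :: "nat \<Rightarrow> complex"
  assumes "p < d" "q < d" "p \<noteq> q" "a < d"
  shows "(\<Sum>b<d. reflection_mat p q $$ (a, b) * g b)
      = g a - 2 / 5 * (if a = p then 1 else if a = q then 2 else 0) * (g p + 2 * g q)"
proof -
  define w :: "nat \<Rightarrow> complex" where "w a = (if a = p then 1 else if a = q then 2 else 0)" for a
  have "(\<Sum>b<d. reflection_mat p q $$ (a, b) * g b)
      = (\<Sum>b<d. (if b = a then g b else 0)) - 2 / 5 * w a * (\<Sum>b<d. w b * g b)"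
    unfolding sum_distrib_left sum_subtractf[symmetric]
    using assms by (intro sum.cong refl) (simp add: reflection_mat_def w_def[symmetric] algebra_simps)
  also have "(\<Sum>b<d. w b * g b) = g p + 2 * g q"
    unfolding w_def by (rule sum_two_points[OF assms(1-3)])
  finally show ?thesis using assms by (simp add: w_def)
qed

lemma unitary_reflection_mat:
  assumes "p < d" "q < d" "p \<noteq> q"
  shows "unitary_mat d (reflection_mat p q)"
proof (rule unitary_matI[OF reflection_mat_carrier])
  fix i j assume ij: "i < d" "j < d"
  have "(\<Sum>a<d. cnj (reflection_mat p q $$ (a, i)) * reflection_mat p q $$ (a, j))
      = (\<Sum>a<d. reflection_mat p q $$ (i, a) * reflection_mat p q $$ (a, j))"
    using ij by (intro sum.cong refl) (auto simp: reflection_mat_def)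
  also have "\<dots> = reflection_mat p q $$ (i, j) - 2 / 5 * (if i = p then 1 else if i = q then 2 else 0) *
      (reflection_mat p q $$ (p, j) + 2 * reflection_mat p q $$ (q, j))"
    by (rule sum_reflection_row[OF assms ij(1)])
  also have "\<dots> = (if i = j then 1 else 0)"
    using ij assms by (auto simp: reflection_mat_def)
  finally show "(\<Sum>a<d. cnj (reflection_mat p q $$ (a, i)) * reflection_mat p q $$ (a, j)) = (if i = j then 1 else 0)" .
qed

lemma reflection_mat_times_index:
  assumes U: "unitary_mat d U" and "p < d" "q < d" "p \<noteq> q" "i < d"
  shows "(reflection_mat p q * U) $$ (p, i) = 3 / 5 * U $$ (p, i) - 4 / 5 * U $$ (q, i)"
    and "(reflection_mat p q * U) $$ (q, i) = - 4 / 5 * U $$ (p, i) - 3 / 5 * U $$ (q, i)"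
proof -
  have *: "(reflection_mat p q * U) $$ (a, i) = (\<Sum>l<d. reflection_mat p q $$ (a, l) * U $$ (l, i))" if "a < d" for a
    using assms that by (intro times_mat_index[OF reflection_mat_carrier unitary_mat_carrier[OF U]])
  show "(reflection_mat p q * U) $$ (p, i) = 3 / 5 * U $$ (p, i) - 4 / 5 * U $$ (q, i)"
    unfolding *[OF assms(2)] sum_reflection_row[OF assms(2,3,4,2)] by (simp add: algebra_simps)
  show "(reflection_mat p q * U) $$ (q, i) = - 4 / 5 * U $$ (p, i) - 3 / 5 * U $$ (q, i)"
    unfolding *[OF assms(3)] sum_reflection_row[OF assms(2,3,4,3)]
    using assms by (simp add: algebra_simps)
qed

text \<open>Expansion of the fourth power of the modulus of x u_p + y u_q for the column u. Phase
  invariance removes all monomials except the balanced ones; the 4 is the square of the binomial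
  coefficient 2.\<close>

lemma integral_quartic_two_points:
  assumes b: "i < d" "p < d" "q < d" and pq: "p \<noteq> q"
  shows "(\<integral>U. (cnj (x * U $$ (p, i) + y * U $$ (q, i)))\<^sup>2 * (x * U $$ (p, i) + y * U $$ (q, i))\<^sup>2 \<partial>\<mu>)
    = (cnj x)\<^sup>2 * x\<^sup>2 * moment i p p p p + (cnj y)\<^sup>2 * y\<^sup>2 * moment i q q q q
      + 4 * (cnj x * x * cnj y * y) * moment i p q p q"
proof -
  note [simp] = integrable_quartic b
  have "(\<integral>U. (cnj (x * U $$ (p, i) + y * U $$ (q, i)))\<^sup>2 * (x * U $$ (p, i) + y * U $$ (q, i))\<^sup>2 \<partial>\<mu>)
    = (\<integral>U. (cnj x)\<^sup>2 * x\<^sup>2 * quartic i p p p p U + (cnj y)\<^sup>2 * y\<^sup>2 * quartic i q q q q U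
        + 4 * (cnj x * x * cnj y * y) * quartic i p q p q U
        + 2 * (cnj x)\<^sup>2 * x * y * quartic i p p p q U + (cnj x)\<^sup>2 * y\<^sup>2 * quartic i p p q q U
        + 2 * cnj x * cnj y * x\<^sup>2 * quartic i p q p p U + 2 * cnj x * cnj y * y\<^sup>2 * quartic i p q q q U
        + (cnj y)\<^sup>2 * x\<^sup>2 * quartic i q q p p U + 2 * (cnj y)\<^sup>2 * x * y * quartic i q q p q U \<partial>\<mu>)"
    by (intro Bochner_Integration.integral_cong refl)
      (simp add: quartic_def power2_eq_square algebra_simps)
  also have "\<dots> = (cnj x)\<^sup>2 * x\<^sup>2 * moment i p p p p + (cnj y)\<^sup>2 * y\<^sup>2 * moment i q q q q
        + 4 * (cnj x * x * cnj y * y) * moment i p q p q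
        + 2 * (cnj x)\<^sup>2 * x * y * moment i p p p q + (cnj x)\<^sup>2 * y\<^sup>2 * moment i p p q q
        + 2 * cnj x * cnj y * x\<^sup>2 * moment i p q p p + 2 * cnj x * cnj y * y\<^sup>2 * moment i p q q q
        + (cnj y)\<^sup>2 * x\<^sup>2 * moment i q q p p + 2 * (cnj y)\<^sup>2 * x * y * moment i q q p q"
    by (simp add: moment_def)
  also have "\<dots> = (cnj x)\<^sup>2 * x\<^sup>2 * moment i p p p p + (cnj y)\<^sup>2 * y\<^sup>2 * moment i q q q q
      + 4 * (cnj x * x * cnj y * y) * moment i p q p q"
    using pq by (simp add: moment_eq_0)
  finally show ?thesis .
qed

text \<open>Reflection invariance gives two linear equations between A = E |u_p|^4, B = E |u_q|^4
  and C = E |u_p u_q|^2, with coefficients 81 = 3^4, 256 = 4^4 and 576 = 4 * 9 * 16 over 625 = 5^4.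
  Their difference yields A = B; then 288 A = 576 C.\<close>

lemma moment_relations:
  assumes b: "i < d" "p < d" "q < d" and pq: "p \<noteq> q"
  shows "moment i q q q q = moment i p p p p" "2 * moment i p q p q = moment i p p p p"
proof -
  let ?R = "reflection_mat p q"
  have *: "moment i a a a a = (\<integral>U. (cnj ((?R * U) $$ (a, i)))\<^sup>2 * ((?R * U) $$ (a, i))\<^sup>2 \<partial>\<mu>)" if "a < d" for a
  proof -
    have "moment i a a a a = (\<integral>U. quartic i a a a a (?R * U) \<partial>\<mu>)"
      unfolding moment_def using b pq that
      by (intro integral_left_mult[symmetric] unitary_reflection_mat measurable_quartic)
    then show ?thesis by (simp only: quartic_def power2_eq_square)
  qed
  have "moment i p p p p = (\<integral>U. (cnj (3 / 5 * U $$ (p, i) + (- 4 / 5) * U $$ (q, i)))\<^sup>2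
      * (3 / 5 * U $$ (p, i) + (- 4 / 5) * U $$ (q, i))\<^sup>2 \<partial>\<mu>)"
    unfolding *[OF b(2)] using b pq
    by (intro Bochner_Integration.integral_cong refl)
      (simp add: space_haar reflection_mat_times_index del: index_mult_mat(1))
  then have 1: "moment i p p p p = 81 / 625 * moment i p p p p + 256 / 625 * moment i q q q q
      + 576 / 625 * moment i p q p q"
    by (simp only: integral_quartic_two_points[OF b pq]) (simp add: power2_eq_square)
  have "moment i q q q q = (\<integral>U. (cnj ((- 4 / 5) * U $$ (p, i) + (- 3 / 5) * U $$ (q, i)))\<^sup>2
      * ((- 4 / 5) * U $$ (p, i) + (- 3 / 5) * U $$ (q, i))\<^sup>2 \<partial>\<mu>)"
    unfolding *[OF b(3)] using b pq
    by (intro Bochner_Integration.integral_cong refl)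
      (simp add: space_haar reflection_mat_times_index del: index_mult_mat(1))
  then have 2: "moment i q q q q = 256 / 625 * moment i p p p p + 81 / 625 * moment i q q q q
      + 576 / 625 * moment i p q p q"
    by (simp only: integral_quartic_two_points[OF b pq]) (simp add: power2_eq_square)
  show eq: "moment i q q q q = moment i p p p p"
    using 1 2 by (simp add: complex_eq_iff field_simps)
  show "2 * moment i p q p q = moment i p p p p"
    using 1 unfolding eq by (simp add: complex_eq_iff field_simps)
qed

text \<open>The integrand is the square of the squared norm of column \<open>i\<close>, hence 1.
  This fixes the scale that the homogeneous relations leave open.\<close>

lemma sum_moment:
  assumes i: "i < d"
  shows "(\<Sum>p<d. \<Sum>q<d. moment i p q p q) = 1"
proof -
  have "(\<Sum>p<d. \<Sum>q<d. moment i p q p q) = (\<integral>U. (\<Sum>p<d. \<Sum>q<d. quartic i p q p q U) \<partial>\<mu>)"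
  proof -
    have "(\<integral>U. (\<Sum>p<d. \<Sum>q<d. quartic i p q p q U) \<partial>\<mu>)
        = (\<Sum>p<d. \<integral>U. (\<Sum>q<d. quartic i p q p q U) \<partial>\<mu>)"
      using i by (intro Bochner_Integration.integral_sum Bochner_Integration.integrable_sum integrable_quartic) auto
    also have "\<dots> = (\<Sum>p<d. \<Sum>q<d. moment i p q p q)"
      unfolding moment_def
      using i by (intro sum.cong refl Bochner_Integration.integral_sum integrable_quartic) auto
    finally show ?thesis by simp
  qed
  also have "\<dots> = (\<integral>U. 1 \<partial>\<mu>)"
  proof (intro Bochner_Integration.integral_cong refl)
    fix U assume "U \<in> space \<mu>"
    then have U: "unitary_mat d U" by (simp add: space_haar)
    have "(\<Sum>p<d. \<Sum>q<d. quartic i p q p q U)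
        = (\<Sum>p<d. cnj (U $$ (p, i)) * U $$ (p, i)) * (\<Sum>q<d. cnj (U $$ (q, i)) * U $$ (q, i))"
      by (simp add: quartic_def sum_product mult_ac)
    then show "(\<Sum>p<d. \<Sum>q<d. quartic i p q p q U) = 1" using i by (simp add: unitary_mat_columns[OF U])
  qed
  finally show ?thesis by (simp add: prob_space)
qed

text \<open>These are the entries of (I + SWAP) / (d (d + 1)), the average of the tensor square of
  the projector onto a Haar random column.\<close>

lemma moment_eq:
  assumes b: "i < d" "p < d" "q < d" "r < d" "s < d"
  shows "moment i p q r s
    = ((if p = r \<and> q = s then 1 else 0) + (if p = s \<and> q = r then 1 else 0)) / (of_nat d * (of_nat d + 1))"
proof -
  define x where "x = moment i i i i i"
  have diag: "moment i a a a a = x" if "a < d" for a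
    using moment_relations(1)[OF b(1) b(1) that] by (cases "a = i") (auto simp: x_def)
  have off: "moment i a c a c = x / 2" if "a < d" "c < d" "a \<noteq> c" for a c
    using moment_relations(2)[OF b(1) that] diag[OF that(1)] by (simp add: field_simps)
  have "1 = (\<Sum>p<d. \<Sum>q<d. moment i p q p q)" using sum_moment[OF b(1)] by simp
  \<comment> \<open>Each of the d^2 pairs contributes x/2 and each of the d diagonal pairs a second
    x/2, so d (d + 1) x / 2 = 1.\<close>
  also have "\<dots> = (\<Sum>p<d. \<Sum>q<d. x / 2 + (if q = p then x / 2 else 0))"
    by (intro sum.cong refl) (auto simp: diag off)
  also have "\<dots> = of_nat d * (of_nat d + 1) * x / 2"
    by (simp add: sum.distrib algebra_simps)
  finally have x: "x / 2 = 1 / (of_nat d * (of_nat d + 1))"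
  proof -
    assume 1: "1 = of_nat d * (of_nat d + 1) * x / 2"
    define C :: complex where "C = of_nat d * (of_nat d + 1)"
    have "1 = C * x / 2" using 1 by (simp only: C_def)
    moreover from this have "C \<noteq> 0" by auto
    ultimately have "x / 2 = 1 / C" by (simp add: nonzero_eq_divide_eq mult.commute)
    then show ?thesis by (simp only: C_def)
  qed
  have sym: "moment i p q q p = moment i p q p q"
    by (simp add: moment_def quartic_def mult_ac)
  show ?thesis
  proof (cases "p = r \<and> q = s \<or> p = s \<and> q = r")
    case True
    have "moment i p q r s = moment i p q p q" using True sym by auto
    also have "\<dots> = (if p = q then 2 else 1) * (x / 2)"
      using diag[OF b(2)] off[OF b(2,3)] by auto
    finally show ?thesis unfolding x using True by auto
  next
    case False
    then have ne: "\<not> (p = r \<and> q = s)" "\<not> (p = s \<and> q = r)" by blast+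
    show ?thesis by (simp only: moment_eq_0[OF b ne] ne if_False add_0 div_0)
  qed
qed

end

subsection \<open>Moments of tensor powers\<close>

text \<open>Histories as extensional functions: sums over product sets of them factor by
  \<open>prod_sum_PiE\<close>, which is awkward for lists.\<close>

abbreviation tuples :: "nat \<Rightarrow> nat \<Rightarrow> (nat \<Rightarrow> nat) set" where
  "tuples d T \<equiv> {..<T} \<rightarrow>\<^sub>E {..<d}"

lemma finite_tuples: "finite (tuples d T)"
  by (intro finite_PiE) auto

lemma tuples_eqI: "a \<in> tuples d T \<Longrightarrow> b \<in> tuples d T \<Longrightarrow> (\<And>k. k < T \<Longrightarrow> a k = b k) \<Longrightarrow> a = b"
  by (rule PiE_ext) auto

text \<open>The \<open>h\<close> component of the vector \<psi> of the overview. The conjugated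
  entry at (\<open>a k\<close>, \<open>h k\<close>) is the entry of \<open>mat_adjoint U\<close> at
  (\<open>h k\<close>, \<open>a k\<close>).\<close>

definition amplitude :: "nat \<Rightarrow> nat \<Rightarrow> ((nat \<Rightarrow> nat) \<Rightarrow> complex) \<Rightarrow> (nat \<Rightarrow> nat) \<Rightarrow> complex mat \<Rightarrow> complex" where
  "amplitude d T v h U = (\<Sum>a\<in>tuples d T. v a * (\<Prod>k<T. cnj (U $$ (a k, h k))))"

lemma cmod_amplitude_square:
  "complex_of_real ((cmod (amplitude d T v h U))\<^sup>2)
    = (\<Sum>a\<in>tuples d T. \<Sum>b\<in>tuples d T. v a * cnj (v b) * (\<Prod>k<T. cnj (U $$ (a k, h k)) * U $$ (b k, h k)))"
proof -
  have "complex_of_real ((cmod (amplitude d T v h U))\<^sup>2) = amplitude d T v h U * cnj (amplitude d T v h U)"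
    by (rule complex_norm_square[unfolded of_real_power[symmetric]])
  then show ?thesis
    by (simp add: amplitude_def cnj_sum cnj_prod sum_product prod.distrib mult_ac)
qed

text \<open>The sets \<open>B k\<close> are arbitrary so that one factorisation serves both
  Parseval, with every outcome free, and collisions, with two positions pinned to the same
  outcome.\<close>

lemma sum_amplitude_square:
  assumes "\<And>k. k < T \<Longrightarrow> finite (B k)"
  shows "complex_of_real (\<Sum>h\<in>PiE {..<T} B. (cmod (amplitude d T v h U))\<^sup>2)
    = (\<Sum>a\<in>tuples d T. \<Sum>b\<in>tuples d T. v a * cnj (v b) *
        (\<Prod>k<T. \<Sum>i\<in>B k. cnj (U $$ (a k, i)) * U $$ (b k, i)))"
proof -
  have "complex_of_real (\<Sum>h\<in>PiE {..<T} B. (cmod (amplitude d T v h U))\<^sup>2)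
      = (\<Sum>h\<in>PiE {..<T} B. \<Sum>a\<in>tuples d T. \<Sum>b\<in>tuples d T. v a * cnj (v b) *
          (\<Prod>k<T. cnj (U $$ (a k, h k)) * U $$ (b k, h k)))"
    unfolding of_real_sum cmod_amplitude_square ..
  also have "\<dots> = (\<Sum>a\<in>tuples d T. \<Sum>b\<in>tuples d T. \<Sum>h\<in>PiE {..<T} B. v a * cnj (v b) *
          (\<Prod>k<T. cnj (U $$ (a k, h k)) * U $$ (b k, h k)))"
    by (subst sum.swap) (intro sum.cong refl sum.swap)
  also have "\<dots> = (\<Sum>a\<in>tuples d T. \<Sum>b\<in>tuples d T. v a * cnj (v b) *
        (\<Prod>k<T. \<Sum>i\<in>B k. cnj (U $$ (a k, i)) * U $$ (b k, i)))"
    by (intro sum.cong refl, subst prod_sum_PiE) (use assms in \<open>auto simp: sum_distrib_left\<close>)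
  finally show ?thesis .
qed

text \<open>Used with \<open>s\<close> the identity and with \<open>s\<close> the exchange of two
  positions, the two patterns that survive averaging.\<close>

lemma sum_tuples_diagonal:
  fixes f :: "(nat \<Rightarrow> nat) \<Rightarrow> (nat \<Rightarrow> nat) \<Rightarrow> complex"
  assumes "\<And>a. a \<in> tuples d T \<Longrightarrow> s a \<in> tuples d T"
  shows "(\<Sum>a\<in>tuples d T. \<Sum>b\<in>tuples d T. f a b * (if b = s a then 1 else 0)) = (\<Sum>a\<in>tuples d T. f a (s a))"
proof (intro sum.cong refl)
  fix a assume a: "a \<in> tuples d T"
  have "(\<Sum>b\<in>tuples d T. f a b * (if b = s a then 1 else 0)) = (\<Sum>b\<in>{s a}. f a b * (if b = s a then 1 else 0))"
    using assms[OF a] by (intro sum.mono_neutral_right finite_tuples) auto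
  then show "(\<Sum>b\<in>tuples d T. f a b * (if b = s a then 1 else 0)) = f a (s a)" by simp
qed

lemma prod_indicator:
  fixes P :: "'a \<Rightarrow> bool"
  assumes "finite A"
  shows "(\<Prod>k\<in>A. if P k then 1 else 0) = (if \<forall>k\<in>A. P k then 1 else (0::complex))"
  using assms by (induction A) auto

lemma amplitude_parseval:
  assumes U: "unitary_mat d U"
  shows "(\<Sum>h\<in>tuples d T. (cmod (amplitude d T v h U))\<^sup>2) = (\<Sum>a\<in>tuples d T. (cmod (v a))\<^sup>2)"
proof -
  have "complex_of_real (\<Sum>h\<in>tuples d T. (cmod (amplitude d T v h U))\<^sup>2)
      = (\<Sum>a\<in>tuples d T. \<Sum>b\<in>tuples d T. v a * cnj (v b) *
        (\<Prod>k<T. \<Sum>i<d. cnj (U $$ (a k, i)) * U $$ (b k, i)))"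
    by (rule sum_amplitude_square) simp
  also have "\<dots> = (\<Sum>a\<in>tuples d T. \<Sum>b\<in>tuples d T. v a * cnj (v b) * (if b = a then 1 else 0))"
  proof (intro sum.cong refl arg_cong2[where f = "(*)"])
    fix a b assume a: "a \<in> tuples d T" and b: "b \<in> tuples d T"
    have "(\<Prod>k<T. \<Sum>i<d. cnj (U $$ (a k, i)) * U $$ (b k, i)) = (\<Prod>k<T. if b k = a k then 1 else 0)"
    proof (intro prod.cong refl)
      fix k assume "k \<in> {..<T}"
      then have "a k < d" "b k < d" using a b by (auto simp: PiE_def Pi_def)
      then show "(\<Sum>i<d. cnj (U $$ (a k, i)) * U $$ (b k, i)) = (if b k = a k then 1 else 0)"
        using unitary_mat_rows[OF U, of "b k" "a k"] by (simp add: mult.commute)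
    qed
    also have "\<dots> = (if b = a then 1 else 0)"
      using tuples_eqI[OF b a] by (auto simp: prod_indicator)
    finally show "(\<Prod>k<T. \<Sum>i<d. cnj (U $$ (a k, i)) * U $$ (b k, i)) = (if b = a then 1 else 0)" .
  qed
  also have "\<dots> = (\<Sum>a\<in>tuples d T. v a * cnj (v a))"
    by (rule sum_tuples_diagonal) simp
  also have "\<dots> = complex_of_real (\<Sum>a\<in>tuples d T. (cmod (v a))\<^sup>2)"
    unfolding of_real_sum by (intro sum.cong refl) (metis complex_norm_square of_real_power)
  finally show ?thesis by (simp only: of_real_eq_iff)
qed

section \<open>Histories with coinciding outcomes\<close>

text \<open>The condition \<open>h j = h k\<close> does not define a product set, but it does once
  the common value \<open>i\<close> is fixed, which makes the factorised sums applicable.\<close>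

lemma tuples_coincidence:
  assumes "j < T" "k < T"
  shows "{h \<in> tuples d T. h j = h k}
    = (\<Union>i<d. PiE {..<T} (\<lambda>l. if l = j \<or> l = k then {i} else {..<d}))" (is "?L = ?R")
proof
  show "?L \<subseteq> ?R"
  proof
    fix h assume h: "h \<in> ?L"
    then have "h j < d" using assms by (auto simp: PiE_def Pi_def)
    moreover have "h \<in> PiE {..<T} (\<lambda>l. if l = j \<or> l = k then {h j} else {..<d})"
      using h by (auto simp: PiE_def Pi_def)
    ultimately show "h \<in> ?R" by blast
  qed
  show "?R \<subseteq> ?L"
  proof
    fix h assume "h \<in> ?R"
    then obtain i where i: "i < d" "h \<in> PiE {..<T} (\<lambda>l. if l = j \<or> l = k then {i} else {..<d})" by blast
    have "h l \<in> {..<d}" if "l < T" for l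
      using PiE_mem[OF i(2), of l] that i(1) by (auto split: if_splits)
    moreover have "h j = i" "h k = i"
      using PiE_mem[OF i(2), of j] PiE_mem[OF i(2), of k] assms by auto
    ultimately show "h \<in> ?L" using i(2) by (auto simp: PiE_def)
  qed
qed

lemma sum_tuples_coincidence:
  fixes f :: "(nat \<Rightarrow> nat) \<Rightarrow> 'a::comm_monoid_add"
  assumes "j < T" "k < T"
  shows "(\<Sum>h | h \<in> tuples d T \<and> h j = h k. f h)
    = (\<Sum>i<d. \<Sum>h\<in>PiE {..<T} (\<lambda>l. if l = j \<or> l = k then {i} else {..<d}). f h)"
  unfolding tuples_coincidence[OF assms]
proof (rule sum.UNION_disjoint)
  show "\<forall>i\<in>{..<d}. finite (PiE {..<T} (\<lambda>l. if l = j \<or> l = k then {i} else {..<d}))"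
    by (intro ballI finite_PiE) auto
  have eq: "h j = i" if "h \<in> PiE {..<T} (\<lambda>l. if l = j \<or> l = k then {i} else {..<d})" for h i
    using PiE_mem[OF that, of j] assms by auto
  show "\<forall>i\<in>{..<d}. \<forall>i'\<in>{..<d}. i \<noteq> i' \<longrightarrow>
      PiE {..<T} (\<lambda>l. if l = j \<or> l = k then {i} else {..<d}) \<inter>
      PiE {..<T} (\<lambda>l. if l = j \<or> l = k then {i'} else {..<d}) = {}"
  proof (intro ballI impI equals0I)
    fix i i' h assume "i \<noteq> i'" and h: "h \<in> PiE {..<T} (\<lambda>l. if l = j \<or> l = k then {i} else {..<d}) \<inter>
      PiE {..<T} (\<lambda>l. if l = j \<or> l = k then {i'} else {..<d})"
    then show False using eq[OF IntD1[OF h]] eq[OF IntD2[OF h]] by simp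
  qed
qed simp

lemma card_tuples_coincidence:
  assumes "j < T" "k < T" "j \<noteq> k"
  shows "card {h \<in> tuples d T. h j = h k} * d = d ^ T"
proof -
  have "card {h \<in> tuples d T. h j = h k} = (\<Sum>h | h \<in> tuples d T \<and> h j = h k. 1)" by simp
  also have "\<dots> = (\<Sum>i<d. card (PiE {..<T} (\<lambda>l. if l = j \<or> l = k then {i} else {..<d})))"
    by (subst sum_tuples_coincidence[OF assms(1,2)]) simp
  also have "\<dots> = (\<Sum>i<d. d ^ (T - 2))"
  proof (intro sum.cong refl)
    fix i
    have "card (PiE {..<T} (\<lambda>l. if l = j \<or> l = k then {i} else {..<d}))
        = (\<Prod>l<T. if l = j \<or> l = k then 1 else d)"
      by (subst card_PiE) (auto intro!: prod.cong)
    also have "\<dots> = (\<Prod>l\<in>{..<T} - {j, k}. d)"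
      using assms by (intro prod.mono_neutral_cong_right) auto
    also have "\<dots> = d ^ (T - 2)" using assms by (simp add: card_Diff_subset numeral_2_eq_2)
    finally show "card (PiE {..<T} (\<lambda>l. if l = j \<or> l = k then {i} else {..<d})) = d ^ (T - 2)" .
  qed
  finally have "card {h \<in> tuples d T. h j = h k} * d = d ^ (T - 2) * (d * d)" by simp
  also have "\<dots> = d ^ (T - 2 + 2)" by (simp add: power_add power2_eq_square)
  \<comment> \<open>Two distinct positions below T force T \<ge> 2, so the truncated subtraction is
    exact.\<close>
  also have "T - 2 + 2 = T" using assms by linarith
  finally show ?thesis .
qed

lemma sum_UNION_le:
  fixes f :: "'a \<Rightarrow> real"
  assumes "finite P" "\<And>x. x \<in> P \<Longrightarrow> finite (S x)" "\<And>x y. x \<in> P \<Longrightarrow> y \<in> S x \<Longrightarrow> 0 \<le> f y"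
  shows "(\<Sum>y\<in>(\<Union>x\<in>P. S x). f y) \<le> (\<Sum>x\<in>P. \<Sum>y\<in>S x. f y)"
  using assms
proof (induction P)
  case (insert x P)
  have "sum f (S x \<union> (\<Union>x\<in>P. S x)) + sum f (S x \<inter> (\<Union>x\<in>P. S x)) = sum f (S x) + sum f (\<Union>x\<in>P. S x)"
    using insert by (intro sum.union_inter) auto
  moreover have "0 \<le> sum f (S x \<inter> (\<Union>x\<in>P. S x))"
    using insert.prems by (intro sum_nonneg) auto
  moreover have "sum f (\<Union>x\<in>P. S x) \<le> (\<Sum>x\<in>P. \<Sum>y\<in>S x. f y)"
    using insert by auto
  ultimately show ?case using insert.hyps by simp
qed simp

text \<open>A union bound over ordered pairs of positions, of which there are at most T^2. It is
  used both for Haar averages and for the weights of the trivial device.\<close>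

lemma sum_not_inj_le:
  fixes f :: "(nat \<Rightarrow> nat) \<Rightarrow> real"
  assumes f: "\<And>h. h \<in> tuples d T \<Longrightarrow> 0 \<le> f h"
    and c: "\<And>j k. j < T \<Longrightarrow> k < T \<Longrightarrow> j \<noteq> k \<Longrightarrow> (\<Sum>h | h \<in> tuples d T \<and> h j = h k. f h) \<le> C"
    and C: "0 \<le> C"
  shows "(\<Sum>h | h \<in> tuples d T \<and> \<not> inj_on h {..<T}. f h) \<le> (real T)\<^sup>2 * C"
proof -
  define P where "P = {(j, k). j < T \<and> k < T \<and> j \<noteq> k}"
  have P: "P \<subseteq> {..<T} \<times> {..<T}" by (auto simp: P_def)
  then have fP: "finite P" by (rule finite_subset) simp
  have "card P \<le> card ({..<T} \<times> {..<T})" by (rule card_mono[OF _ P]) simp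
  then have cP: "real (card P) \<le> (real T)\<^sup>2" by (simp add: power2_eq_square flip: of_nat_mult)
  have "{h. h \<in> tuples d T \<and> \<not> inj_on h {..<T}} = (\<Union>(j, k)\<in>P. {h. h \<in> tuples d T \<and> h j = h k})"
    by (auto simp: P_def inj_on_def)
  then have "(\<Sum>h | h \<in> tuples d T \<and> \<not> inj_on h {..<T}. f h)
      = (\<Sum>h\<in>(\<Union>(j, k)\<in>P. {h. h \<in> tuples d T \<and> h j = h k}). f h)" by simp
  also have "\<dots> \<le> (\<Sum>(j, k)\<in>P. \<Sum>h | h \<in> tuples d T \<and> h j = h k. f h)"
  proof -
    have "(\<Sum>h\<in>(\<Union>x\<in>P. {h. h \<in> tuples d T \<and> h (fst x) = h (snd x)}). f h)
        \<le> (\<Sum>x\<in>P. \<Sum>h | h \<in> tuples d T \<and> h (fst x) = h (snd x). f h)"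
      using fP f finite_tuples[of T d] by (intro sum_UNION_le) auto
    then show ?thesis by (simp add: case_prod_beta)
  qed
  also have "\<dots> \<le> (\<Sum>x\<in>P. C)"
    by (intro sum_mono) (auto simp: P_def intro!: c)
  also have "\<dots> = real (card P) * C" by simp
  also have "\<dots> \<le> (real T)\<^sup>2 * C" using cP C by (intro mult_right_mono)
  finally show ?thesis .
qed

lemma swap_tuple:
  assumes "j < T" "k < T" "j \<noteq> k" "a \<in> tuples d T"
  shows "a(j := a k, k := a j) \<in> tuples d T"
  using assms by (auto simp: PiE_def Pi_def extensional_def)

text \<open>Entries of a unitary have modulus at most 1. The crude bound provides integrability and
  the boundedness needed for right invariance.\<close>

lemma amplitude_le:
  assumes U: "unitary_mat d U" and h: "h \<in> tuples d T"
  shows "cmod (amplitude d T v h U) \<le> (\<Sum>a\<in>tuples d T. cmod (v a))"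
proof -
  have "cmod (amplitude d T v h U) \<le> (\<Sum>a\<in>tuples d T. cmod (v a * (\<Prod>k<T. cnj (U $$ (a k, h k)))))"
    unfolding amplitude_def by (rule norm_sum)
  also have "\<dots> \<le> (\<Sum>a\<in>tuples d T. cmod (v a) * 1)"
  proof (intro sum_mono)
    fix a assume a: "a \<in> tuples d T"
    have "(\<Prod>k<T. cmod (U $$ (a k, h k))) \<le> 1"
    proof (intro prod_le_1 conjI)
      fix k assume "k \<in> {..<T}"
      then have "a k < d" "h k < d" using a h by (auto simp: PiE_def Pi_def)
      then show "cmod (U $$ (a k, h k)) \<le> 1" by (rule unitary_mat_entry_le[OF U])
    qed simp
    then show "cmod (v a * (\<Prod>k<T. cnj (U $$ (a k, h k)))) \<le> cmod (v a) * 1"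
      by (simp add: norm_mult prod_norm[symmetric] mult_left_le)
  qed
  finally show ?thesis by simp
qed

text \<open>Both images have T elements, so their complements in {0, ..., d - 1} have equal size,
  and any bijection between these completes the matching of \<open>h k\<close> with
  \<open>h' k\<close>.\<close>

lemma bij_betw_extend_tuples:
  assumes h: "h \<in> tuples d T" "inj_on h {..<T}" and h': "h' \<in> tuples d T" "inj_on h' {..<T}"
  obtains \<pi> where "bij_betw \<pi> {..<d} {..<d}" "\<And>k. k < T \<Longrightarrow> \<pi> (h k) = h' k"
proof -
  let ?A = "h ` {..<T}" and ?B = "h' ` {..<T}"
  have sub: "?A \<subseteq> {..<d}" "?B \<subseteq> {..<d}" using h(1) h'(1) by (auto simp: PiE_def Pi_def)
  have card: "card ?A = T" "card ?B = T" using card_image[OF h(2)] card_image[OF h'(2)] by simp_all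
  have "card ({..<d} - ?A) = card ({..<d} - ?B)"
    using sub card by (simp add: card_Diff_subset)
  then obtain g where g: "bij_betw g ({..<d} - ?A) ({..<d} - ?B)"
    using finite_same_card_bij[of "{..<d} - ?A" "{..<d} - ?B"] by auto
  define f where "f = h' \<circ> the_inv_into {..<T} h"
  have f: "bij_betw f ?A ?B"
    unfolding f_def
    by (rule bij_betw_trans[OF bij_betw_the_inv_into[OF inj_on_imp_bij_betw[OF h(2)]]
          inj_on_imp_bij_betw[OF h'(2)]])
  define \<pi> where "\<pi> x = (if x \<in> ?A then f x else g x)" for x
  have "bij_betw \<pi> (?A \<union> ({..<d} - ?A)) (?B \<union> ({..<d} - ?B))"
    unfolding \<pi>_def by (rule bij_betw_disjoint_Un[OF f g]) auto
  moreover have "?A \<union> ({..<d} - ?A) = {..<d}" "?B \<union> ({..<d} - ?B) = {..<d}" using sub by auto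
  ultimately have "bij_betw \<pi> {..<d} {..<d}" by simp
  moreover have "\<pi> (h k) = h' k" if "k < T" for k
    using that the_inv_into_f_f[OF h(2), of k] by (simp add: \<pi>_def f_def)
  ultimately show ?thesis using that by blast
qed

section \<open>Haar averages of squared amplitudes\<close>

context haar
begin

lemma measurable_amplitude:
  assumes h: "h \<in> tuples d T"
  shows "amplitude d T v h \<in> borel_measurable \<mu>"
  unfolding amplitude_def[abs_def]
proof (intro borel_measurable_sum borel_measurable_times borel_measurable_prod borel_measurable_const)
  fix a k assume "a \<in> tuples d T" "k \<in> {..<T}"
  then have "a k < d" "h k < d" using h by (auto simp: PiE_def Pi_def)
  then show "(\<lambda>U. cnj (U $$ (a k, h k))) \<in> borel_measurable \<mu>" by (rule measurable_cnj_entry)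
qed

lemma measurable_amplitude_square:
  assumes h: "h \<in> tuples d T"
  shows "(\<lambda>U. (cmod (amplitude d T v h U))\<^sup>2) \<in> borel_measurable \<mu>"
  by (intro borel_measurable_power measurable_compose[OF measurable_amplitude[OF h] borel_measurable_norm])

lemma amplitude_square_le:
  assumes "unitary_mat d U" "h \<in> tuples d T"
  shows "norm ((cmod (amplitude d T v h U))\<^sup>2) \<le> (\<Sum>a\<in>tuples d T. cmod (v a))\<^sup>2"
  using amplitude_le[OF assms] by (simp add: power_mono)

lemma integrable_amplitude_square:
  assumes h: "h \<in> tuples d T"
  shows "integrable \<mu> (\<lambda>U. (cmod (amplitude d T v h U))\<^sup>2)"
  by (rule integrable_haar[OF measurable_amplitude_square[OF h] amplitude_square_le[OF _ h]])

lemma integral_amplitude_inj: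
  assumes h: "h \<in> tuples d T" "inj_on h {..<T}" and h': "h' \<in> tuples d T" "inj_on h' {..<T}"
  shows "(\<integral>U. (cmod (amplitude d T v h U))\<^sup>2 \<partial>\<mu>) = (\<integral>U. (cmod (amplitude d T v h' U))\<^sup>2 \<partial>\<mu>)"
proof -
  obtain \<pi> where \<pi>: "bij_betw \<pi> {..<d} {..<d}" "\<And>k. k < T \<Longrightarrow> \<pi> (h k) = h' k"
    by (rule bij_betw_extend_tuples[OF h h']) blast
  have \<pi>_less: "\<pi> i < d" if "i < d" for i using bij_betw_apply[OF \<pi>(1), of i] that by simp
  \<comment> \<open>The permutation matrix of \<pi>: column \<open>i\<close> of \<open>U * W\<close>
    is column \<open>\<pi> i\<close> of \<open>U\<close>, so right multiplication by
    \<open>W\<close> carries the amplitude at \<open>h\<close> to the one at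
    \<open>h'\<close>.\<close>
  define W where "W = mat d d (\<lambda>(a, b). if a = \<pi> b then 1 else 0 :: complex)"
  have Wc: "W \<in> carrier_mat d d" by (simp add: W_def)
  have W: "unitary_mat d W"
  proof (rule unitary_matI[OF Wc])
    fix i j assume ij: "i < d" "j < d"
    have "(\<Sum>p<d. cnj (W $$ (p, i)) * W $$ (p, j)) = cnj (W $$ (\<pi> i, i)) * W $$ (\<pi> i, j)"
      using ij \<pi>_less by (intro sum_lessThan_single) (auto simp: W_def)
    also have "\<dots> = (if i = j then 1 else 0)"
      using ij \<pi>_less bij_betw_imp_inj_on[OF \<pi>(1)] by (auto simp: W_def inj_on_def)
    finally show "(\<Sum>p<d. cnj (W $$ (p, i)) * W $$ (p, j)) = (if i = j then 1 else 0)" .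
  qed
  have UW: "(U * W) $$ (p, i) = U $$ (p, \<pi> i)" if "unitary_mat d U" "p < d" "i < d" for U p i
  proof -
    have "(U * W) $$ (p, i) = (\<Sum>l<d. U $$ (p, l) * W $$ (l, i))"
      using that by (intro times_mat_index[OF unitary_mat_carrier Wc])
    also have "\<dots> = U $$ (p, \<pi> i) * W $$ (\<pi> i, i)"
      using that \<pi>_less by (intro sum_lessThan_single) (auto simp: W_def)
    finally show ?thesis using that \<pi>_less by (simp add: W_def)
  qed
  have amp: "amplitude d T v h (U * W) = amplitude d T v h' U" if U: "unitary_mat d U" for U
    unfolding amplitude_def
  proof (intro sum.cong refl arg_cong2[where f = "(*)"] prod.cong)
    fix a k assume "a \<in> tuples d T" "k \<in> {..<T}"
    then have "a k < d" "h k < d" "k < T" using h by (auto simp: PiE_def Pi_def)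
    then show "cnj ((U * W) $$ (a k, h k)) = cnj (U $$ (a k, h' k))"
      using UW[OF U, of "a k" "h k"] \<pi>(2)[of k] by (simp del: index_mult_mat(1))
  qed
  have "(\<lambda>U. (cmod (amplitude d T v h (U * W)))\<^sup>2) \<in> borel_measurable \<mu> \<longleftrightarrow>
      (\<lambda>U. (cmod (amplitude d T v h' U))\<^sup>2) \<in> borel_measurable \<mu>"
    by (rule measurable_cong) (simp add: space_haar amp)
  then have m: "(\<lambda>U. (cmod (amplitude d T v h (U * W)))\<^sup>2) \<in> borel_measurable \<mu>"
    using measurable_amplitude_square[OF h'(1)] by simp
  have "(\<integral>U. (cmod (amplitude d T v h U))\<^sup>2 \<partial>\<mu>) = (\<integral>U. (cmod (amplitude d T v h (U * W)))\<^sup>2 \<partial>\<mu>)"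
    by (rule integral_right_mult[OF measurable_amplitude_square[OF h(1)] amplitude_square_le[OF _ h(1)] W m, symmetric])
  also have "\<dots> = (\<integral>U. (cmod (amplitude d T v h' U))\<^sup>2 \<partial>\<mu>)"
    by (intro Bochner_Integration.integral_cong refl) (simp add: space_haar amp)
  finally show ?thesis .
qed

text \<open>At a position other than \<open>j\<close> and \<open>k\<close> the outcome is summed
  freely, and orthonormality of the rows forces \<open>b l = a l\<close>. The positions
  \<open>j\<close> and \<open>k\<close> both see column \<open>i\<close> and leave one quartic
  monomial.\<close>

lemma sum_coincidence_amplitude:
  assumes jk: "j < T" "k < T" "j \<noteq> k" and U: "unitary_mat d U"
  shows "complex_of_real (\<Sum>h | h \<in> tuples d T \<and> h j = h k. (cmod (amplitude d T v h U))\<^sup>2)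
    = (\<Sum>i<d. \<Sum>a\<in>tuples d T. \<Sum>b\<in>tuples d T. v a * cnj (v b) *
        (if \<forall>l\<in>{..<T} - {j, k}. b l = a l then 1 else 0) * quartic i (a j) (a k) (b j) (b k) U)"
proof -
  have "complex_of_real (\<Sum>h | h \<in> tuples d T \<and> h j = h k. (cmod (amplitude d T v h U))\<^sup>2)
      = (\<Sum>i<d. complex_of_real (\<Sum>h\<in>PiE {..<T} (\<lambda>l. if l = j \<or> l = k then {i} else {..<d}).
           (cmod (amplitude d T v h U))\<^sup>2))"
    by (simp only: sum_tuples_coincidence[OF jk(1,2)] of_real_sum)
  also have "\<dots> = (\<Sum>i<d. \<Sum>a\<in>tuples d T. \<Sum>b\<in>tuples d T. v a * cnj (v b) *
        (\<Prod>l<T. \<Sum>x\<in>(if l = j \<or> l = k then {i} else {..<d}). cnj (U $$ (a l, x)) * U $$ (b l, x)))"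
    by (intro sum.cong refl sum_amplitude_square) simp
  also have "\<dots> = (\<Sum>i<d. \<Sum>a\<in>tuples d T. \<Sum>b\<in>tuples d T. v a * cnj (v b) *
        (if \<forall>l\<in>{..<T} - {j, k}. b l = a l then 1 else 0) * quartic i (a j) (a k) (b j) (b k) U)"
  proof (intro sum.cong refl)
    fix i a b assume a: "a \<in> tuples d T" and b: "b \<in> tuples d T"
    define g where "g l = (\<Sum>x\<in>(if l = j \<or> l = k then {i} else {..<d}). cnj (U $$ (a l, x)) * U $$ (b l, x))" for l
    have "(\<Prod>l<T. g l) = g j * (g k * (\<Prod>l\<in>{..<T} - {j, k}. g l))"
    proof -
      have "{..<T} - {j, k} = {..<T} - {j} - {k}" by auto
      then show ?thesis using jk by (simp add: prod.remove[of _ j] prod.remove[of _ k])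
    qed
    also have "(\<Prod>l\<in>{..<T} - {j, k}. g l) = (\<Prod>l\<in>{..<T} - {j, k}. if b l = a l then 1 else 0)"
    proof (intro prod.cong refl)
      fix l assume l: "l \<in> {..<T} - {j, k}"
      then have "a l < d" "b l < d" using a b by (auto simp: PiE_def Pi_def)
      then show "g l = (if b l = a l then 1 else 0)"
        using l unitary_mat_rows[OF U, of "b l" "a l"] by (simp add: g_def mult.commute)
    qed
    also have "\<dots> = (if \<forall>l\<in>{..<T} - {j, k}. b l = a l then 1 else 0)"
      by (rule prod_indicator) simp
    finally have "(\<Prod>l<T. g l) = (if \<forall>l\<in>{..<T} - {j, k}. b l = a l then 1 else 0) * (g j * g k)"
      by (simp add: mult_ac)
    also have "g j * g k = quartic i (a j) (a k) (b j) (b k) U"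
      by (simp add: g_def quartic_def mult_ac)
    finally show "v a * cnj (v b) *
        (\<Prod>l<T. \<Sum>x\<in>(if l = j \<or> l = k then {i} else {..<d}). cnj (U $$ (a l, x)) * U $$ (b l, x))
      = v a * cnj (v b) * (if \<forall>l\<in>{..<T} - {j, k}. b l = a l then 1 else 0) * quartic i (a j) (a k) (b j) (b k) U"
      unfolding g_def by (simp only: mult.assoc)
  qed
  finally show ?thesis .
qed

text \<open>After averaging, the sum is the quadratic form of (I + SWAP) / (d + 1) at
  \<open>v\<close>, where SWAP exchanges the positions \<open>j\<close> and \<open>k\<close>. It
  preserves the norm, so each of the two terms is at most the squared norm of
  \<open>v\<close>.\<close>

lemma integral_coincidence_le:
  assumes jk: "j < T" "k < T" "j \<noteq> k" and d: "0 < d"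
  shows "(\<integral>U. (\<Sum>h | h \<in> tuples d T \<and> h j = h k. (cmod (amplitude d T v h U))\<^sup>2) \<partial>\<mu>)
    \<le> 2 / (real d + 1) * (\<Sum>a\<in>tuples d T. (cmod (v a))\<^sup>2)"
proof -
  define H where "H = tuples d T"
  define N where "N = (\<Sum>a\<in>H. (cmod (v a))\<^sup>2)"
  define e where "e a b = (if \<forall>l\<in>{..<T} - {j, k}. b l = a l then 1 else 0 :: complex)" for a b :: "nat \<Rightarrow> nat"
  define sw where "sw a = a(j := a k, k := a j)" for a :: "nat \<Rightarrow> nat"
  have sw: "sw a \<in> H" "sw (sw a) = a" if "a \<in> H" for a
    using swap_tuple[OF jk, of a d] that jk by (auto simp: sw_def H_def)
  have less: "a l < d" if "a \<in> H" "l < T" for a l using that by (auto simp: H_def PiE_def Pi_def)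
  let ?S = "\<lambda>U. \<Sum>h | h \<in> tuples d T \<and> h j = h k. (cmod (amplitude d T v h U))\<^sup>2"
  have "complex_of_real (\<integral>U. ?S U \<partial>\<mu>) = (\<integral>U. complex_of_real (?S U) \<partial>\<mu>)"
    by (rule integral_complex_of_real[symmetric])
  also have "\<dots> = (\<integral>U. (\<Sum>i<d. \<Sum>a\<in>H. \<Sum>b\<in>H. v a * cnj (v b) * e a b * quartic i (a j) (a k) (b j) (b k) U) \<partial>\<mu>)"
    unfolding H_def e_def
    by (intro Bochner_Integration.integral_cong refl sum_coincidence_amplitude[OF jk]) (simp add: space_haar)
  also have "\<dots> = (\<Sum>i<d. \<Sum>a\<in>H. \<Sum>b\<in>H. v a * cnj (v b) * e a b * moment i (a j) (a k) (b j) (b k))"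
  proof -
    have int: "integrable \<mu> (\<lambda>U. v a * cnj (v b) * e a b * quartic i (a j) (a k) (b j) (b k) U)"
      if "i \<in> {..<d}" "a \<in> H" "b \<in> H" for i a b
      using that less jk by (intro integrable_mult_right integrable_quartic) auto
    show ?thesis
      unfolding moment_def
      using int by (simp add: Bochner_Integration.integral_sum Bochner_Integration.integrable_sum)
  qed
  also have "\<dots> = (\<Sum>i<d. \<Sum>a\<in>H. \<Sum>b\<in>H. v a * cnj (v b) *
      ((if b = a then 1 else 0) + (if b = sw a then 1 else 0)) / (of_nat d * (of_nat d + 1)))"
  proof (intro sum.cong refl)
    fix i a b assume i: "i \<in> {..<d}" and a: "a \<in> H" and b: "b \<in> H"
    have 1: "b = a \<longleftrightarrow> (\<forall>l\<in>{..<T} - {j, k}. b l = a l) \<and> a j = b j \<and> a k = b k"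
    proof
      assume r: "(\<forall>l\<in>{..<T} - {j, k}. b l = a l) \<and> a j = b j \<and> a k = b k"
      show "b = a"
      proof (rule tuples_eqI)
        show "b \<in> tuples d T" "a \<in> tuples d T" using a b by (simp_all add: H_def)
        show "b l = a l" if "l < T" for l
          using r that by (cases "l = j"; cases "l = k") auto
      qed
    qed simp
    have 2: "b = sw a \<longleftrightarrow> (\<forall>l\<in>{..<T} - {j, k}. b l = a l) \<and> a j = b k \<and> a k = b j"
    proof
      show "b = sw a \<Longrightarrow> (\<forall>l\<in>{..<T} - {j, k}. b l = a l) \<and> a j = b k \<and> a k = b j"
        using jk by (simp add: sw_def)
      assume r: "(\<forall>l\<in>{..<T} - {j, k}. b l = a l) \<and> a j = b k \<and> a k = b j"
      show "b = sw a"
      proof (rule tuples_eqI)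
        show "b \<in> tuples d T" "sw a \<in> tuples d T" using b sw(1)[OF a] by (simp_all add: H_def)
        have sw_jk: "sw a j = a k" "sw a k = a j" using jk by (simp_all add: sw_def)
        show "b l = sw a l" if "l < T" for l
        proof (cases "l = j \<or> l = k")
          case True
          then show ?thesis using r sw_jk by metis
        next
          case False
          then have "b l = a l" using r that by blast
          then show ?thesis using False by (simp add: sw_def)
        qed
      qed
    qed
    have m: "moment i (a j) (a k) (b j) (b k) = ((if a j = b j \<and> a k = b k then 1 else 0)
        + (if a j = b k \<and> a k = b j then 1 else 0)) / (of_nat d * (of_nat d + 1))"
      using i less[OF a] less[OF b] jk by (intro moment_eq) auto
    show "v a * cnj (v b) * e a b * moment i (a j) (a k) (b j) (b k) = v a * cnj (v b) *
      ((if b = a then 1 else 0) + (if b = sw a then 1 else 0)) / (of_nat d * (of_nat d + 1))"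
    proof (cases "\<forall>l\<in>{..<T} - {j, k}. b l = a l")
      case True
      have "e a b = 1" unfolding e_def by (rule if_P[OF True])
      moreover have "b = a \<longleftrightarrow> a j = b j \<and> a k = b k" "b = sw a \<longleftrightarrow> a j = b k \<and> a k = b j"
        using 1 2 True by blast+
      ultimately show ?thesis by (simp only: m mult_1_right times_divide_eq_right)
    next
      case False
      have "e a b = 0" unfolding e_def by (rule if_not_P[OF False])
      moreover have "b \<noteq> a" "b \<noteq> sw a" using 1 2 False by blast+
      ultimately show ?thesis by (simp only: if_False add_0 mult_zero_left mult_zero_right div_0)
    qed
  qed
  \<comment> \<open>The summand is the same for all d values of the common outcome, which cancels
    the factor d in d (d + 1).\<close>
  also have "\<dots> = (\<Sum>a\<in>H. \<Sum>b\<in>H. v a * cnj (v b) *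
      ((if b = a then 1 else 0) + (if b = sw a then 1 else 0))) / (of_nat d + 1)"
    using d by (simp add: sum_divide_distrib[symmetric])
  also have "(\<Sum>a\<in>H. \<Sum>b\<in>H. v a * cnj (v b) * ((if b = a then 1 else 0) + (if b = sw a then 1 else 0)))
      = (\<Sum>a\<in>H. v a * cnj (v a)) + (\<Sum>a\<in>H. v a * cnj (v (sw a)))"
  proof -
    have "(\<Sum>a\<in>H. \<Sum>b\<in>H. v a * cnj (v b) * (if b = a then 1 else 0)) = (\<Sum>a\<in>H. v a * cnj (v a))"
      unfolding H_def by (rule sum_tuples_diagonal) simp
    moreover have "(\<Sum>a\<in>H. \<Sum>b\<in>H. v a * cnj (v b) * (if b = sw a then 1 else 0)) = (\<Sum>a\<in>H. v a * cnj (v (sw a)))"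
      using sw(1) unfolding H_def by (rule sum_tuples_diagonal)
    ultimately show ?thesis by (simp only: distrib_left sum.distrib)
  qed
  finally have ceq: "complex_of_real (\<integral>U. ?S U \<partial>\<mu>)
      = ((\<Sum>a\<in>H. v a * cnj (v a)) + (\<Sum>a\<in>H. v a * cnj (v (sw a)))) / of_real (real d + 1)" by simp
  have eq: "(\<integral>U. ?S U \<partial>\<mu>) = Re ((\<Sum>a\<in>H. v a * cnj (v a)) + (\<Sum>a\<in>H. v a * cnj (v (sw a)))) / (real d + 1)"
    using arg_cong[OF ceq, where f = Re] by (simp only: Re_complex_of_real Re_divide_of_real)
  have "Re (\<Sum>a\<in>H. v a * cnj (v a)) = N"
    unfolding N_def Re_sum by (intro sum.cong refl) (simp add: cmod_power2, simp add: power2_eq_square)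
  \<comment> \<open>The arithmetic-geometric mean inequality termwise; the exchange is an involution
    on \<open>H\<close>, so both squares sum to \<open>N\<close>.\<close>
  moreover have "Re (\<Sum>a\<in>H. v a * cnj (v (sw a))) \<le> N"
  proof -
    have "Re (\<Sum>a\<in>H. v a * cnj (v (sw a))) \<le> (\<Sum>a\<in>H. ((cmod (v a))\<^sup>2 + (cmod (v (sw a)))\<^sup>2) / 2)"
      unfolding Re_sum
    proof (intro sum_mono)
      fix a
      have "Re (v a * cnj (v (sw a))) \<le> cmod (v a) * cmod (v (sw a))"
        using complex_Re_le_cmod[of "v a * cnj (v (sw a))"] by (simp add: norm_mult)
      also have "\<dots> \<le> ((cmod (v a))\<^sup>2 + (cmod (v (sw a)))\<^sup>2) / 2"
        using sum_squares_bound[of "cmod (v a)" "cmod (v (sw a))"] by simp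
      finally show "Re (v a * cnj (v (sw a))) \<le> ((cmod (v a))\<^sup>2 + (cmod (v (sw a)))\<^sup>2) / 2" .
    qed
    also have "\<dots> = (N + (\<Sum>a\<in>H. (cmod (v (sw a)))\<^sup>2)) / 2"
      by (simp add: N_def sum.distrib sum_divide_distrib[symmetric])
    also have "(\<Sum>a\<in>H. (cmod (v (sw a)))\<^sup>2) = N"
      unfolding N_def by (rule sum.reindex_bij_witness[of _ sw sw]) (use sw in auto)
    finally show ?thesis by simp
  qed
  ultimately show ?thesis
    unfolding eq N_def[symmetric, unfolded H_def] by (simp add: divide_right_mono)
qed

lemma integral_amplitude_ge:
  assumes h: "h \<in> tuples d T" "inj_on h {..<T}" and d: "0 < d"
  shows "(1 - 2 * (real T)\<^sup>2 / real d) / real d ^ T * (\<Sum>a\<in>tuples d T. (cmod (v a))\<^sup>2)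
    \<le> (\<integral>U. (cmod (amplitude d T v h U))\<^sup>2 \<partial>\<mu>)"
proof -
  define N where "N = (\<Sum>a\<in>tuples d T. (cmod (v a))\<^sup>2)"
  define f where "f h' = (\<integral>U. (cmod (amplitude d T v h' U))\<^sup>2 \<partial>\<mu>)" for h'
  define I where "I = {h \<in> tuples d T. inj_on h {..<T}}"
  have N0: "0 \<le> N" unfolding N_def by (intro sum_nonneg) simp
  have f0: "0 \<le> f h'" for h' unfolding f_def by (intro Bochner_Integration.integral_nonneg) simp
  have total: "(\<Sum>h'\<in>tuples d T. f h') = N"
  proof -
    have "(\<Sum>h'\<in>tuples d T. f h') = (\<integral>U. (\<Sum>h'\<in>tuples d T. (cmod (amplitude d T v h' U))\<^sup>2) \<partial>\<mu>)"
      unfolding f_def by (rule Bochner_Integration.integral_sum[symmetric]) (rule integrable_amplitude_square)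
    also have "\<dots> = (\<integral>U. N \<partial>\<mu>)"
      unfolding N_def by (intro Bochner_Integration.integral_cong refl amplitude_parseval) (simp add: space_haar)
    finally show ?thesis by (simp add: prob_space)
  qed
  have "(\<Sum>h' | h' \<in> tuples d T \<and> \<not> inj_on h' {..<T}. f h') \<le> (real T)\<^sup>2 * (2 / (real d + 1) * N)"
  proof (rule sum_not_inj_le)
    fix j k assume jk: "j < T" "k < T" "j \<noteq> k"
    have "(\<Sum>h' | h' \<in> tuples d T \<and> h' j = h' k. f h')
        = (\<integral>U. (\<Sum>h' | h' \<in> tuples d T \<and> h' j = h' k. (cmod (amplitude d T v h' U))\<^sup>2) \<partial>\<mu>)"
      unfolding f_def
      by (rule Bochner_Integration.integral_sum[symmetric]) (auto intro: integrable_amplitude_square)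
    also have "\<dots> \<le> 2 / (real d + 1) * N"
      unfolding N_def by (rule integral_coincidence_le[OF jk d])
    finally show "(\<Sum>h' | h' \<in> tuples d T \<and> h' j = h' k. f h') \<le> 2 / (real d + 1) * N" .
  qed (use f0 N0 in auto)
  also have "\<dots> \<le> (real T)\<^sup>2 * (2 / real d * N)"
    using N0 d by (intro mult_left_mono mult_right_mono divide_left_mono) auto
  finally have bad: "(\<Sum>h' | h' \<in> tuples d T \<and> \<not> inj_on h' {..<T}. f h') \<le> 2 * (real T)\<^sup>2 / real d * N"
    by (simp add: mult_ac)
  have "(\<Sum>h'\<in>tuples d T. f h') = (\<Sum>h'\<in>I. f h') + (\<Sum>h' | h' \<in> tuples d T \<and> \<not> inj_on h' {..<T}. f h')"
    unfolding I_def
    by (subst sum.union_disjoint[symmetric]) (auto simp: finite_tuples intro!: sum.cong)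
  then have "(1 - 2 * (real T)\<^sup>2 / real d) * N \<le> (\<Sum>h'\<in>I. f h')"
    using bad total by (simp add: algebra_simps)
  \<comment> \<open>All injective histories have the same average, so a lower bound on the sum
    becomes one for the given \<open>h\<close>. The number of such histories need only be bounded
    above, by d^T.\<close>
  also have "\<dots> = (\<Sum>h'\<in>I. f h)"
    by (intro sum.cong refl) (auto simp: I_def f_def intro: integral_amplitude_inj[OF _ _ h])
  also have "\<dots> = real (card I) * f h" by simp
  also have "\<dots> \<le> real d ^ T * f h"
  proof (intro mult_right_mono f0)
    have "card I \<le> card (tuples d T)" unfolding I_def by (intro card_mono finite_tuples) auto
    then show "real (card I) \<le> real d ^ T" by (simp add: card_PiE flip: of_nat_power)
  qed
  finally show ?thesis
    using d by (simp add: f_def N_def field_simps)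
qed

end

subsection \<open>The lower bound\<close>

abbreviation tuple_list :: "nat \<Rightarrow> (nat \<Rightarrow> nat) \<Rightarrow> nat list" where
  "tuple_list T f \<equiv> map f [0..<T]"

lemma tuple_list_in_histories: "f \<in> tuples d T \<Longrightarrow> tuple_list T f \<in> histories d T"
  by (auto simp: histories_def PiE_def Pi_def)

lemma sum_histories_tuples:
  fixes g :: "nat list \<Rightarrow> 'a::comm_monoid_add"
  shows "(\<Sum>h\<in>histories d T. g h) = (\<Sum>f\<in>tuples d T. g (tuple_list T f))"
proof (rule sum.reindex_bij_witness[of _ "tuple_list T" "\<lambda>h. restrict ((!) h) {..<T}"])
  fix h assume h: "h \<in> histories d T"
  then show eq: "tuple_list T (restrict ((!) h) {..<T}) = h"
    by (intro nth_equalityI) (auto simp: histories_def)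
  show "restrict ((!) h) {..<T} \<in> tuples d T"
    using h by (auto simp: histories_def subset_iff)
  show "g (tuple_list T (restrict ((!) h) {..<T})) = g h" by (simp only: eq)
next
  fix f assume f: "f \<in> tuples d T"
  then show "tuple_list T f \<in> histories d T" by (rule tuple_list_in_histories)
  show "restrict ((!) (tuple_list T f)) {..<T} = f"
    using f by (auto simp: fun_eq_iff PiE_def extensional_def)
qed

lemma path_weight_tuples:
  "path_weight M (tuple_list T f) (tuple_list T b) (tuple_list T a) = (\<Prod>k<T. M (f k) $$ (b k, a k))"
  by (simp add: path_weight_def)

lemma Re_sum_list_map: "Re (\<Sum>x\<leftarrow>xs. g x) = (\<Sum>x\<leftarrow>xs. Re (g x))"
  by (induction xs) auto

text \<open>A single list \<open>vs\<close> describes both devices, which makes their probabilities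
  comparable term by term. \<open>G\<close> is left general, to stand for either guess at the
  history \<open>f\<close>.\<close>

lemma outcome_amplitudes:
  assumes v: "valid_protocol d m T \<rho>0 \<Phi> F" and f: "f \<in> tuples d T" and G: "psd_mat m G"
  obtains vs :: "((nat \<Rightarrow> nat) \<Rightarrow> complex) list" where
    "Re (mtrace (G * run d m \<rho>0 \<Phi> (trivial_povm d) (tuple_list T f)))
      = (\<Sum>v\<leftarrow>vs. 1 / real d ^ T * (\<Sum>a\<in>tuples d T. (cmod (v a))\<^sup>2))"
    "\<And>U. unitary_mat d U \<Longrightarrow> Re (mtrace (G * run d m \<rho>0 \<Phi> (rotated_povm d U) (tuple_list T f)))
      = (\<Sum>v\<leftarrow>vs. (cmod (amplitude d T v f U))\<^sup>2)"
proof -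
  have \<rho>: "psd_mat m \<rho>0"
    and \<Phi>: "\<And>h. length h < T \<Longrightarrow> set h \<subseteq> {..<d} \<Longrightarrow> kraus_channel m (d * m) (\<Phi> h)"
    using v by (auto simp: valid_protocol_def density_mat_def)
  obtain ws :: "(nat list \<Rightarrow> complex) list" where ws:
    "\<forall>M. (\<forall>i<d. M i \<in> carrier_mat d d) \<longrightarrow> mtrace (G * run d m \<rho>0 \<Phi> M (tuple_list T f)) =
      (\<Sum>v\<leftarrow>ws. \<Sum>a\<in>histories d T. \<Sum>b\<in>histories d T. path_weight M (tuple_list T f) b a * (v a * cnj (v b)))"
    using trace_run_path_representation[where \<Phi> = \<Phi>, OF \<rho> \<Phi> tuple_list_in_histories[OF f] G] ..
  have less: "a k < d" if "a \<in> tuples d T" "k < T" for a k using that by (auto simp: PiE_def Pi_def)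
  define vs where "vs = map (\<lambda>w a. w (tuple_list T a)) ws"
  have rep: "mtrace (G * run d m \<rho>0 \<Phi> M (tuple_list T f)) =
      (\<Sum>v\<leftarrow>vs. \<Sum>a\<in>tuples d T. \<Sum>b\<in>tuples d T. (\<Prod>k<T. M (f k) $$ (b k, a k)) * (v a * cnj (v b)))"
    if "\<forall>i<d. M i \<in> carrier_mat d d" for M
    unfolding ws[THEN spec, THEN mp, OF that] vs_def by (simp add: sum_histories_tuples path_weight_tuples o_def)
  show ?thesis
  proof (rule that[of vs])
    have one: "(\<Sum>a\<in>tuples d T. \<Sum>b\<in>tuples d T. (\<Prod>k<T. trivial_povm d (f k) $$ (b k, a k)) * (v a * cnj (v b)))
        = complex_of_real (1 / real d ^ T * (\<Sum>a\<in>tuples d T. (cmod (v a))\<^sup>2))" for v :: "(nat \<Rightarrow> nat) \<Rightarrow> complex"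
    proof -
      have "(\<Sum>a\<in>tuples d T. \<Sum>b\<in>tuples d T. (\<Prod>k<T. trivial_povm d (f k) $$ (b k, a k)) * (v a * cnj (v b)))
          = (\<Sum>a\<in>tuples d T. \<Sum>b\<in>tuples d T. 1 / of_nat d ^ T * (v a * cnj (v b)) * (if b = a then 1 else 0))"
      proof (intro sum.cong refl)
        fix a b assume a: "a \<in> tuples d T" and b: "b \<in> tuples d T"
        have "(\<Prod>k<T. trivial_povm d (f k) $$ (b k, a k)) = (\<Prod>k<T. 1 / of_nat d * (if b k = a k then 1 else 0))"
          using less[OF a] less[OF b] by (intro prod.cong refl) (simp add: trivial_povm_index)
        also have "\<dots> = 1 / of_nat d ^ T * (if b = a then 1 else 0)"
          using tuples_eqI[OF b a] by (auto simp: prod.distrib prod_indicator power_one_over simp del: divide_eq_0_iff)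
        finally show "(\<Prod>k<T. trivial_povm d (f k) $$ (b k, a k)) * (v a * cnj (v b))
            = 1 / of_nat d ^ T * (v a * cnj (v b)) * (if b = a then 1 else 0)" by (simp only: mult_ac)
      qed
      also have "\<dots> = (\<Sum>a\<in>tuples d T. 1 / of_nat d ^ T * (v a * cnj (v a)))"
        by (rule sum_tuples_diagonal) simp
      also have "\<dots> = complex_of_real (1 / real d ^ T * (\<Sum>a\<in>tuples d T. (cmod (v a))\<^sup>2))"
        by (simp add: sum_distrib_left complex_norm_square[symmetric])
      finally show ?thesis .
    qed
    show "Re (mtrace (G * run d m \<rho>0 \<Phi> (trivial_povm d) (tuple_list T f)))
        = (\<Sum>v\<leftarrow>vs. 1 / real d ^ T * (\<Sum>a\<in>tuples d T. (cmod (v a))\<^sup>2))"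
      by (subst rep) (simp_all only: one trivial_povm_carrier Re_sum_list_map Re_complex_of_real simp_thms)
    fix U assume U: "unitary_mat d U"
    note c = unitary_mat_carrier[OF U]
    have two: "(\<Sum>a\<in>tuples d T. \<Sum>b\<in>tuples d T. (\<Prod>k<T. rotated_povm d U (f k) $$ (b k, a k)) * (v a * cnj (v b)))
        = complex_of_real ((cmod (amplitude d T v f U))\<^sup>2)" for v :: "(nat \<Rightarrow> nat) \<Rightarrow> complex"
      unfolding cmod_amplitude_square
    proof (intro sum.cong refl)
      fix a b assume a: "a \<in> tuples d T" and b: "b \<in> tuples d T"
      have "(\<Prod>k<T. rotated_povm d U (f k) $$ (b k, a k)) = (\<Prod>k<T. cnj (U $$ (a k, f k)) * U $$ (b k, f k))"
        using less[OF a] less[OF b] less[OF f] by (intro prod.cong refl) (simp add: rotated_povm_index[OF c])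
      then show "(\<Prod>k<T. rotated_povm d U (f k) $$ (b k, a k)) * (v a * cnj (v b))
          = v a * cnj (v b) * (\<Prod>k<T. cnj (U $$ (a k, f k)) * U $$ (b k, f k))" by (simp only: mult_ac)
    qed
    show "Re (mtrace (G * run d m \<rho>0 \<Phi> (rotated_povm d U) (tuple_list T f)))
        = (\<Sum>v\<leftarrow>vs. (cmod (amplitude d T v f U))\<^sup>2)"
      by (subst rep) (simp_all only: two rotated_povm_carrier[OF c] Re_sum_list_map Re_complex_of_real simp_thms)
  qed
qed

lemma mtrace_run_trivial_nonneg:
  assumes "valid_protocol d m T \<rho>0 \<Phi> F" "f \<in> tuples d T" "psd_mat m G"
  shows "0 \<le> Re (mtrace (G * run d m \<rho>0 \<Phi> (trivial_povm d) (tuple_list T f)))"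
proof -
  obtain vs :: "((nat \<Rightarrow> nat) \<Rightarrow> complex) list" where
    vs: "Re (mtrace (G * run d m \<rho>0 \<Phi> (trivial_povm d) (tuple_list T f)))
      = (\<Sum>v\<leftarrow>vs. 1 / real d ^ T * (\<Sum>a\<in>tuples d T. (cmod (v a))\<^sup>2))"
    by (rule outcome_amplitudes[OF assms]) blast
  show ?thesis unfolding vs by (induction vs) (simp_all add: sum_nonneg)
qed

context haar
begin

lemma outcome_integral:
  assumes v: "valid_protocol d m T \<rho>0 \<Phi> F" and f: "f \<in> tuples d T" and G: "psd_mat m G"
  shows "integrable \<mu> (\<lambda>U. Re (mtrace (G * run d m \<rho>0 \<Phi> (rotated_povm d U) (tuple_list T f))))" (is "integrable \<mu> ?r")
    and "0 \<le> (\<integral>U. Re (mtrace (G * run d m \<rho>0 \<Phi> (rotated_povm d U) (tuple_list T f))) \<partial>\<mu>)"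
    and "0 < d \<Longrightarrow> inj_on f {..<T} \<Longrightarrow>
      (1 - 2 * (real T)\<^sup>2 / real d) * Re (mtrace (G * run d m \<rho>0 \<Phi> (trivial_povm d) (tuple_list T f)))
      \<le> (\<integral>U. Re (mtrace (G * run d m \<rho>0 \<Phi> (rotated_povm d U) (tuple_list T f))) \<partial>\<mu>)"
proof -
  obtain vs :: "((nat \<Rightarrow> nat) \<Rightarrow> complex) list" where
    triv: "Re (mtrace (G * run d m \<rho>0 \<Phi> (trivial_povm d) (tuple_list T f)))
      = (\<Sum>v\<leftarrow>vs. 1 / real d ^ T * (\<Sum>a\<in>tuples d T. (cmod (v a))\<^sup>2))"
    and rot: "\<And>U. unitary_mat d U \<Longrightarrow> ?r U = (\<Sum>v\<leftarrow>vs. (cmod (amplitude d T v f U))\<^sup>2)"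
    by (rule outcome_amplitudes[OF v f G]) blast
  have int: "integrable \<mu> (\<lambda>U. \<Sum>v\<leftarrow>vs. (cmod (amplitude d T v f U))\<^sup>2) \<and>
      (\<integral>U. (\<Sum>v\<leftarrow>vs. (cmod (amplitude d T v f U))\<^sup>2) \<partial>\<mu>) = (\<Sum>v\<leftarrow>vs. \<integral>U. (cmod (amplitude d T v f U))\<^sup>2 \<partial>\<mu>)" for vs
    by (induction vs) (simp_all add: integrable_amplitude_square[OF f])
  have "integrable \<mu> ?r \<longleftrightarrow> integrable \<mu> (\<lambda>U. \<Sum>v\<leftarrow>vs. (cmod (amplitude d T v f U))\<^sup>2)"
    by (rule Bochner_Integration.integrable_cong) (auto simp: space_haar rot)
  then show "integrable \<mu> ?r" using int by blast
  have eq: "(\<integral>U. ?r U \<partial>\<mu>) = (\<Sum>v\<leftarrow>vs. \<integral>U. (cmod (amplitude d T v f U))\<^sup>2 \<partial>\<mu>)"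
    using int by (subst Bochner_Integration.integral_cong[OF refl rot]) (auto simp: space_haar)
  show "0 \<le> (\<integral>U. ?r U \<partial>\<mu>)"
    unfolding eq by (induction vs) simp_all
  assume d: "0 < d" and inj: "inj_on f {..<T}"
  have "(1 - 2 * (real T)\<^sup>2 / real d) * (1 / real d ^ T * (\<Sum>a\<in>tuples d T. (cmod (v a))\<^sup>2))
      \<le> (\<integral>U. (cmod (amplitude d T v f U))\<^sup>2 \<partial>\<mu>)" for v
    using integral_amplitude_ge[OF f inj d, of v] by simp
  then show "(1 - 2 * (real T)\<^sup>2 / real d) * Re (mtrace (G * run d m \<rho>0 \<Phi> (trivial_povm d) (tuple_list T f)))
      \<le> (\<integral>U. ?r U \<partial>\<mu>)"
    unfolding eq triv sum_list_const_mult[symmetric] by (intro sum_list_mono)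
qed

text \<open>With Q and R the rejection probabilities under the trivial and the averaged rotated
  device, the success probability is 1/2 + (Q - R)/2. The assumption \<open>small\<close> makes 1 -
  \<epsilon> nonnegative, so that inequalities may be multiplied by it.\<close>

lemma success_prob_le:
  assumes v: "valid_protocol d m T \<rho>0 \<Phi> F" and d: "0 < d" and small: "2 * (real T)\<^sup>2 \<le> real d"
  shows "success_prob d \<mu> m T \<rho>0 \<Phi> F \<le> 1 / 2 + 3 * (real T)\<^sup>2 / (2 * real d)"
proof -
  define G where "G f = 1\<^sub>m m - F (tuple_list T f)" for f
  define q where "q f = Re (mtrace (G f * run d m \<rho>0 \<Phi> (trivial_povm d) (tuple_list T f)))" for f
  define r where "r f U = Re (mtrace (G f * run d m \<rho>0 \<Phi> (rotated_povm d U) (tuple_list T f)))" for f U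
  define \<epsilon> where "\<epsilon> = 2 * (real T)\<^sup>2 / real d"
  have \<rho>: "\<rho>0 \<in> carrier_mat m m" "mtrace \<rho>0 = 1"
    and \<Phi>: "\<And>h. length h < T \<Longrightarrow> set h \<subseteq> {..<d} \<Longrightarrow> kraus_channel m (d * m) (\<Phi> h)"
    using v by (auto simp: valid_protocol_def density_mat_def psd_mat_def)
  have F: "psd_mat m (F (tuple_list T f))" "psd_mat m (G f)" if "f \<in> tuples d T" for f
    using v tuple_list_in_histories[OF that] by (simp_all add: valid_protocol_def histories_def G_def)
  have \<epsilon>: "0 \<le> \<epsilon>" "\<epsilon> \<le> 1" using small d by (simp_all add: \<epsilon>_def)
  have q0: "0 \<le> q f" if "f \<in> tuples d T" for f
    unfolding q_def by (rule mtrace_run_trivial_nonneg[OF v that F(2)[OF that]])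
  \<comment> \<open>The effects of the two guesses add up to the identity, so \<open>q f\<close> is
    d^(-T) minus the nonnegative weight of the other guess.\<close>
  have q1: "q f \<le> 1 / real d ^ T" if f: "f \<in> tuples d T" for f
  proof -
    have Fc: "F (tuple_list T f) \<in> carrier_mat m m" using F[OF f] by (simp add: psd_mat_def)
    have "mtrace (run d m \<rho>0 \<Phi> (trivial_povm d) (tuple_list T f)) = 1 / of_nat d ^ length (tuple_list T f)"
      using tuple_list_in_histories[OF f]
      by (intro mtrace_run_trivial[where T = T] \<rho> \<Phi>) (auto simp: histories_def)
    then have "q f = Re (1 / of_nat d ^ T) - Re (mtrace (F (tuple_list T f) * run d m \<rho>0 \<Phi> (trivial_povm d) (tuple_list T f)))"
      unfolding q_def G_def mtrace_complement_times[OF Fc run_carrier[OF \<rho>(1)]] by simp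
    moreover have "Re (1 / of_nat d ^ T) = 1 / real d ^ T"
      by (metis Re_complex_of_real of_real_1 of_real_divide of_real_of_nat_eq of_real_power)
    ultimately show ?thesis using mtrace_run_trivial_nonneg[OF v f F(1)[OF f]] by simp
  qed
  have rej_triv: "reject_prob d m T \<rho>0 \<Phi> F (trivial_povm d) = (\<Sum>f\<in>tuples d T. q f)"
    by (simp add: reject_prob_def sum_histories_tuples q_def G_def)
  have rej_rot: "reject_prob d m T \<rho>0 \<Phi> F (rotated_povm d U) = (\<Sum>f\<in>tuples d T. r f U)" for U
    by (simp add: reject_prob_def sum_histories_tuples r_def G_def)
  have r_int: "integrable \<mu> (r f)" and r0: "0 \<le> (\<integral>U. r f U \<partial>\<mu>)" if "f \<in> tuples d T" for f
    unfolding r_def using outcome_integral(1,2)[OF v that F(2)[OF that]] by blast+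
  have r_ge: "(1 - \<epsilon>) * q f \<le> (\<integral>U. r f U \<partial>\<mu>)" if "f \<in> tuples d T" "inj_on f {..<T}" for f
    unfolding r_def q_def \<epsilon>_def using outcome_integral(3)[OF v that(1) F(2)[OF that(1)] d that(2)] .
  define I where "I = {f \<in> tuples d T. inj_on f {..<T}}"
  have bad: "(\<Sum>f | f \<in> tuples d T \<and> \<not> inj_on f {..<T}. q f) \<le> (real T)\<^sup>2 * (1 / real d)"
  proof (rule sum_not_inj_le[OF q0])
    fix j k assume jk: "j < T" "k < T" "j \<noteq> k"
    let ?S = "{f \<in> tuples d T. f j = f k}"
    have "(\<Sum>f | f \<in> tuples d T \<and> f j = f k. q f) \<le> (\<Sum>f | f \<in> tuples d T \<and> f j = f k. 1 / real d ^ T)"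
      by (intro sum_mono) (auto intro: q1)
    also have "\<dots> = real (card ?S) / real d ^ T" by simp
    also have "\<dots> = 1 / real d"
    proof -
      have "real (card ?S) * real d = real d ^ T"
        using arg_cong[OF card_tuples_coincidence[OF jk, of d], where f = real]
        by (simp only: of_nat_mult of_nat_power)
      then show ?thesis using d by (simp add: frac_eq_eq)
    qed
    finally show "(\<Sum>f | f \<in> tuples d T \<and> f j = f k. q f) \<le> 1 / real d" .
  qed simp_all
  have split: "(\<Sum>f\<in>tuples d T. g f) = (\<Sum>f\<in>I. g f) + (\<Sum>f | f \<in> tuples d T \<and> \<not> inj_on f {..<T}. g f)"
    for g :: "(nat \<Rightarrow> nat) \<Rightarrow> real"
    unfolding I_def
    by (subst sum.union_disjoint[symmetric]) (auto simp: finite_tuples intro!: sum.cong)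
  define Q where "Q = (\<Sum>f\<in>tuples d T. q f)"
  have Q1: "Q \<le> 1"
  proof -
    have "Q \<le> (\<Sum>f\<in>tuples d T. 1 / real d ^ T)" unfolding Q_def by (intro sum_mono q1)
    also have "\<dots> = 1" using d by (simp add: card_PiE)
    finally show ?thesis .
  qed
  \<comment> \<open>The 3 is 2 + 1: a loss of at most \<epsilon> = 2 T^2 / d in the comparison on
    injective histories, where Q \<le> 1 is used, and T^2 / d for collisions under the trivial
    device.\<close>
  have "Q - 3 * (real T)\<^sup>2 / real d \<le> (\<Sum>f\<in>tuples d T. \<integral>U. r f U \<partial>\<mu>)"
  proof -
    have "\<epsilon> * Q \<le> \<epsilon> * 1" using \<epsilon>(1) Q1 by (rule mult_left_mono[rotated])
    moreover have "(1 - \<epsilon>) * ((real T)\<^sup>2 / real d) \<le> 1 * ((real T)\<^sup>2 / real d)"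
      using \<epsilon> by (intro mult_right_mono) auto
    moreover have "3 * (real T)\<^sup>2 / real d = \<epsilon> * 1 + 1 * ((real T)\<^sup>2 / real d)"
      by (simp add: \<epsilon>_def)
    ultimately have "Q - 3 * (real T)\<^sup>2 / real d \<le> Q - \<epsilon> * Q - (1 - \<epsilon>) * ((real T)\<^sup>2 / real d)"
      by linarith
    also have "\<dots> = (1 - \<epsilon>) * (Q - (real T)\<^sup>2 / real d)"
      by (simp only: left_diff_distrib right_diff_distrib mult_1_left)
    also have "\<dots> \<le> (1 - \<epsilon>) * (\<Sum>f\<in>I. q f)"
      using bad split[of q] \<epsilon> by (intro mult_left_mono) (auto simp: Q_def)
    also have "\<dots> \<le> (\<Sum>f\<in>I. \<integral>U. r f U \<partial>\<mu>)"
      unfolding sum_distrib_left by (intro sum_mono r_ge) (auto simp: I_def)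
    \<comment> \<open>For the rotated device the histories with a repetition need no estimate: their
      averages are nonnegative and only increase the sum.\<close>
    also have "\<dots> \<le> (\<Sum>f\<in>tuples d T. \<integral>U. r f U \<partial>\<mu>)"
      by (rule sum_mono2) (auto simp: finite_tuples I_def r0)
    finally show ?thesis .
  qed
  moreover have "accept_prob d m T \<rho>0 \<Phi> F (trivial_povm d) = 1 - Q"
    unfolding Q_def rej_triv[symmetric]
    using d by (intro accept_prob_eq[OF v trivial_povm_carrier]) (simp add: trivial_povm_index)
  moreover have "(\<integral>U. accept_prob d m T \<rho>0 \<Phi> F (rotated_povm d U) \<partial>\<mu>) = 1 - (\<Sum>f\<in>tuples d T. \<integral>U. r f U \<partial>\<mu>)"
  proof -
    have "(\<integral>U. accept_prob d m T \<rho>0 \<Phi> F (rotated_povm d U) \<partial>\<mu>) = (\<integral>U. 1 - (\<Sum>f\<in>tuples d T. r f U) \<partial>\<mu>)"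
    proof (intro Bochner_Integration.integral_cong refl)
      fix U assume "U \<in> space \<mu>"
      then have U: "unitary_mat d U" by (simp add: space_haar)
      note c = unitary_mat_carrier[OF U]
      show "accept_prob d m T \<rho>0 \<Phi> F (rotated_povm d U) = 1 - (\<Sum>f\<in>tuples d T. r f U)"
        unfolding rej_rot[symmetric]
        by (intro accept_prob_eq[OF v rotated_povm_carrier[OF c]])
          (simp add: rotated_povm_index[OF c] unitary_mat_rows[OF U])
    qed
    also have "\<dots> = (\<integral>U. 1 \<partial>\<mu>) - (\<integral>U. (\<Sum>f\<in>tuples d T. r f U) \<partial>\<mu>)"
      by (intro Bochner_Integration.integral_diff Bochner_Integration.integrable_sum r_int) simp
    also have "(\<integral>U. (\<Sum>f\<in>tuples d T. r f U) \<partial>\<mu>) = (\<Sum>f\<in>tuples d T. \<integral>U. r f U \<partial>\<mu>)"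
      by (intro Bochner_Integration.integral_sum r_int)
    finally show ?thesis by (simp add: prob_space)
  qed
  ultimately show ?thesis unfolding success_prob_def by (simp add: field_simps)
qed

end

theorem theorem1:
  shows "\<forall>\<delta>>0. \<exists>c>0. \<exists>D. \<forall>d\<ge>D. \<forall>\<mu> m T \<rho>0 \<Phi> F.
           haar_measure d \<mu> \<longrightarrow> valid_protocol d m T \<rho>0 \<Phi> F \<longrightarrow>
           success_prob d \<mu> m T \<rho>0 \<Phi> F \<ge> 1/2 + \<delta> \<longrightarrow>
           real T \<ge> c * sqrt (real d)"
proof (intro allI impI)
  fix \<delta> :: real assume \<delta>: "\<delta> > 0"
  \<comment> \<open>If T < c sqrt d, the bound 1/2 on \<open>c\<close> gives 2 T^2 \<le> d, as
    \<open>success_prob_le\<close> requires, and the bound sqrt \<delta> / 2 gives T^2 \<le>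
    \<delta> d / 4. The success probability is then at most 1/2 + 3 \<delta> / 8, below 1/2 +
    \<delta>.\<close>
  define c where "c = min (1 / 2) (sqrt \<delta> / 2)"
  have c: "c > 0" "c\<^sup>2 \<le> 1 / 4" "c\<^sup>2 \<le> \<delta> / 4"
  proof -
    show c0: "c > 0" using \<delta> by (simp add: c_def)
    have "c\<^sup>2 \<le> (1 / 2)\<^sup>2" "c\<^sup>2 \<le> (sqrt \<delta> / 2)\<^sup>2"
      using c0 by (intro power_mono; simp add: c_def)+
    then show "c\<^sup>2 \<le> 1 / 4" "c\<^sup>2 \<le> \<delta> / 4" using \<delta> by (simp_all add: power2_eq_square)
  qed
  \<comment> \<open>The threshold \<open>D\<close> is 1; the bound holds in every positive
    dimension.\<close>
  have "real T \<ge> c * sqrt (real d)"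
    if "d \<ge> 1" and \<mu>: "haar_measure d \<mu>" and v: "valid_protocol d m T \<rho>0 \<Phi> F"
      and s: "success_prob d \<mu> m T \<rho>0 \<Phi> F \<ge> 1/2 + \<delta>" for d \<mu> m T \<rho>0 \<Phi> F
  proof (rule ccontr)
    interpret haar d \<mu> by unfold_locales (rule \<mu>)
    assume "\<not> real T \<ge> c * sqrt (real d)"
    then have "(real T)\<^sup>2 \<le> (c * sqrt (real d))\<^sup>2" by (intro power_mono) auto
    then have T: "(real T)\<^sup>2 \<le> c\<^sup>2 * real d" by (simp add: power_mult_distrib)
    have d: "0 < d" using \<open>d \<ge> 1\<close> by simp
    have "c\<^sup>2 * real d \<le> 1 / 4 * real d" "c\<^sup>2 * real d \<le> \<delta> / 4 * real d"
      using c by (intro mult_right_mono; simp)+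
    then have "2 * (real T)\<^sup>2 \<le> real d" and T\<delta>: "(real T)\<^sup>2 \<le> \<delta> / 4 * real d" using T by linarith+
    then have "success_prob d \<mu> m T \<rho>0 \<Phi> F \<le> 1 / 2 + 3 * (real T)\<^sup>2 / (2 * real d)"
      by (intro success_prob_le[OF v d])
    moreover have "3 * (real T)\<^sup>2 / (2 * real d) \<le> 3 * (\<delta> / 4 * real d) / (2 * real d)"
      using T\<delta> d by (intro divide_right_mono mult_left_mono) auto
    moreover have "3 * (\<delta> / 4 * real d) / (2 * real d) = 3 / 8 * \<delta>" using d by simp
    ultimately show False using s \<delta> by linarith
  qed
  then show "\<exists>c>0. \<exists>D. \<forall>d\<ge>D. \<forall>\<mu> m T \<rho>0 \<Phi> F.
           haar_measure d \<mu> \<longrightarrow> valid_protocol d m T \<rho>0 \<Phi> F \<longrightarrow>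
           success_prob d \<mu> m T \<rho>0 \<Phi> F \<ge> 1/2 + \<delta> \<longrightarrow>
           real T \<ge> c * sqrt (real d)"
    using c(1) by blast
qed

end
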